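(* Let $M$ be a connected compact $3$-dimensional manifold without boundary and let $A$ be an elliptic self-adjoint first order differential operator with smooth coefficients acting on columns of two complex-valued half-densities over $M$, with trace-free principal symbol $A_1(x,\xi)$. Let $v^+(x,\xi)$ be the normalised eigenvector of $A_1(x,\xi)$ corresponding to its positive eigenvalue. Then for all $(x,\xi)$ with $\xi\ne0$ $$-i\{[v^+]^*,v^+\}(x,\xi)=\frac{\mathbf c}2\,\frac{\overset{*}T{}^{\alpha\beta}(x)\,\xi_\alpha\xi_\beta}{(g^{\mu\nu}(x)\,\xi_\mu\xi_\nu)^{3/2}},$$ where $g$ is the metric, $\mathbf c=\pm1$ the relative orientation, and $\overset{*}T$ the (Hodge-dualised) torsion of the teleparallel connection, all determined by the principal symbol $A_1$.
   Context: Summation over repeated indices is used; $^*$ on columns/matrices is Hermitian conjugation; subscripts $x^\alpha$, $\xi_\alpha$ denote partial derivatives. Ellipticity: $\det A_1(x,\xi)\ne0$ for $\xi\neq0$. $v^+$ is chosen locally smoothly; it is defined up to a phase factor, which does not affect the left-hand side. $\{P,R\}:=P_{x^\alpha}R_{\xi_\alpha}-P_{\xi_\alpha}R_{x^\alpha}$. Metric: $\det A_1(x,\xi)=-g^{\alpha\beta}(x)\xi_\alpha\xi_\beta$ defines a Riemannian metric; indices are raised and lowered with it. Frame: write $A_1(x,\xi)=\sigma^\alpha(x)\xi_\alpha$ with trace-free Hermitian $2\times2$ matrices $\sigma^\alpha$, and let $V_1{}^\alpha:=\operatorname{Re}(\sigma^\alpha)_{12}$, $V_2{}^\alpha:=-\operatorname{Im}(\sigma^\alpha)_{12}$,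 $V_3{}^\alpha:=(\sigma^\alpha)_{11}$. The vector fields $V_1,V_2,V_3$ form a global $g$-orthonormal frame on $M$ (so $M$ is parallelizable and orientable). Fix an orientation and work only in local coordinates with that orientation. Coframe: $\mathbf V_{k\beta}:=g_{\beta\gamma}V_k{}^\gamma$. Relative orientation: $\mathbf c:=\operatorname{sgn}\det V_j{}^\alpha$, equivalently $\mathbf c=-\frac i2\sqrt{\det g_{\alpha\beta}}\operatorname{tr}\bigl((A_1)_{\xi_1}(A_1)_{\xi_2}(A_1)_{\xi_3}\bigr)$. Teleparallel connection: the affine connection for which a covector $\xi$ at $x$ is parallel to a covector $\eta$ at $y$ iff $A_1(x,\xi)=A_1(y,\eta)$; equivalently $\nabla_\mu V_j{}^\alpha=0$, where $\nabla_\mu v^\alpha=\partial v^\alpha/\partial x^\mu+\Gamma^\alpha{}_{\mu\beta}v^\beta$, so that $\Gamma^\alpha{}_{\mu\beta}=V_k{}^\alpha\,\partial\mathbf V_{k\beta}/\partial x^\mu$. Torsion: $T^\alpha{}_{\beta\gamma}:=\Gamma^\alpha{}_{\beta\gamma}-\Gamma^\alpha{}_{\gamma\beta}$. Hodge-dualised torsion: $\overset{*}T{}^\alpha{}_\beta:=\frac12T^{\alpha\gamma\delta}\varepsilon_{\gamma\delta\beta}\sqrt{\det g_{\mu\nu}}$, with $\varepsilon$ totally antisymmetric, $\varepsilon_{123}=+1$. *)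

theory Defs
  imports "HOL-Analysis.Analysis"
begin

section \<open>Smooth maps between normed spaces\<close>

primrec continuously_differentiable_on ::
  "nat \<Rightarrow> 'b::real_normed_vector set \<Rightarrow> ('b \<Rightarrow> 'c::real_normed_vector) \<Rightarrow> bool" where
  "continuously_differentiable_on 0 S f \<longleftrightarrow> continuous_on S f"
| "continuously_differentiable_on (Suc k) S f \<longleftrightarrow>
     (\<forall>x\<in>S. f differentiable (at x)) \<and>
     (\<forall>v. continuously_differentiable_on k S (\<lambda>x. frechet_derivative f (at x) v))"

text \<open>Only used for open sets \<open>S\<close>.\<close>

definition smooth_on :: "'b::real_normed_vector set \<Rightarrow> ('b \<Rightarrow> 'c::real_normed_vector) \<Rightarrow> bool" where
  "smooth_on S f \<longleftrightarrow> (\<forall>k. continuously_differentiable_on k S f)"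

section \<open>Smooth 3-manifolds\<close>

text \<open>A chart is a pair of its domain \<open>U\<close> and its coordinate map, whose values outside \<open>U\<close>
  are irrelevant. Charts map onto open subsets of \<open>real^3\<close>, so there is no boundary.\<close>

type_synonym 'a chart = "'a set \<times> ('a \<Rightarrow> real^3)"

definition chart_range :: "'a chart \<Rightarrow> (real^3) set" where
  "chart_range \<kappa> = snd \<kappa> ` fst \<kappa>"

definition is_chart :: "'a topology \<Rightarrow> 'a chart \<Rightarrow> bool" where
  "is_chart M \<kappa> \<longleftrightarrow> openin M (fst \<kappa>) \<and> open (chart_range \<kappa>) \<and>
     homeomorphic_map (subtopology M (fst \<kappa>)) (top_of_set (chart_range \<kappa>)) (snd \<kappa>)"

text \<open>The part of the range of \<open>\<kappa>\<close> that is covered by \<open>\<kappa>'\<close>, and the coordinate change from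
  \<open>\<kappa>\<close> to \<open>\<kappa>'\<close> defined there.\<close>

definition overlap :: "'a chart \<Rightarrow> 'a chart \<Rightarrow> (real^3) set" where
  "overlap \<kappa> \<kappa>' = snd \<kappa> ` (fst \<kappa> \<inter> fst \<kappa>')"

definition transition :: "'a chart \<Rightarrow> 'a chart \<Rightarrow> real^3 \<Rightarrow> real^3" where
  "transition \<kappa> \<kappa>' = snd \<kappa>' \<circ> inv_into (fst \<kappa>) (snd \<kappa>)"

definition compatible :: "'a chart \<Rightarrow> 'a chart \<Rightarrow> bool" where
  "compatible \<kappa> \<kappa>' \<longleftrightarrow>
     smooth_on (overlap \<kappa> \<kappa>') (transition \<kappa> \<kappa>') \<and> smooth_on (overlap \<kappa>' \<kappa>) (transition \<kappa>' \<kappa>)"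

definition smooth_atlas :: "'a topology \<Rightarrow> 'a chart set \<Rightarrow> bool" where
  "smooth_atlas M \<A> \<longleftrightarrow>
     (\<forall>\<kappa>\<in>\<A>. is_chart M \<kappa>) \<and> (\<Union>\<kappa>\<in>\<A>. fst \<kappa>) = topspace M \<and>
     (\<forall>\<kappa>\<in>\<A>. \<forall>\<kappa>'\<in>\<A>. compatible \<kappa> \<kappa>')"

text \<open>The smooth structure is given by the maximal atlas \<open>\<A>\<close>. Second countability is not listed
  since all manifolds below are compact, which implies it.\<close>

definition smooth_manifold :: "'a topology \<Rightarrow> 'a chart set \<Rightarrow> bool" where
  "smooth_manifold M \<A> \<longleftrightarrow> Hausdorff_space M \<and> smooth_atlas M \<A> \<and>
     (\<forall>\<kappa>. is_chart M \<kappa> \<and> (\<forall>\<kappa>'\<in>\<A>. compatible \<kappa> \<kappa>') \<longrightarrow> \<kappa> \<in> \<A>)"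

definition oriented_atlas :: "'a topology \<Rightarrow> 'a chart set \<Rightarrow> 'a chart set \<Rightarrow> bool" where
  "oriented_atlas M \<A> \<O> \<longleftrightarrow> \<O> \<subseteq> \<A> \<and> smooth_atlas M \<O> \<and>
     (\<forall>\<kappa>\<in>\<O>. \<forall>\<kappa>'\<in>\<O>. \<forall>x\<in>overlap \<kappa> \<kappa>'. det (jacobian (transition \<kappa> \<kappa>') (at x)) > 0)"

section \<open>Half-densities and first order operators\<close>

text \<open>A field on the manifold is given by its local representations in all charts of the atlas;
  the values of \<open>u \<kappa>\<close> outside \<open>chart_range \<kappa>\<close> are irrelevant.\<close>

definition half_density_columns :: "'a chart set \<Rightarrow> ('a chart \<Rightarrow> real^3 \<Rightarrow> complex^2) set" where
  "half_density_columns \<A> = {u.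
     (\<forall>\<kappa>\<in>\<A>. smooth_on (chart_range \<kappa>) (u \<kappa>)) \<and>
     (\<forall>\<kappa>\<in>\<A>. \<forall>\<kappa>'\<in>\<A>. \<forall>x\<in>overlap \<kappa> \<kappa>'.
        u \<kappa> x = sqrt \<bar>det (jacobian (transition \<kappa> \<kappa>') (at x))\<bar> *\<^sub>R u \<kappa>' (transition \<kappa> \<kappa>' x))}"

definition hermitian_product :: "complex^2 \<Rightarrow> complex^2 \<Rightarrow> complex" where
  "hermitian_product u w = (\<Sum>j\<in>UNIV. cnj (u $ j) * w $ j)"

text \<open>The integral of a density \<open>\<rho>\<close> over the manifold, computed from a finite list of charts whose
  domains cover it: the \<open>i\<close>-th chart contributes the part of its domain that is not covered by
  the preceding ones. By the transformation law of densities the value is the same for all such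
  lists.\<close>

definition finite_chart_cover :: "'a topology \<Rightarrow> 'a chart set \<Rightarrow> 'a chart list \<Rightarrow> bool" where
  "finite_chart_cover M \<A> \<kappa>s \<longleftrightarrow> set \<kappa>s \<subseteq> \<A> \<and> (\<Union>\<kappa>\<in>set \<kappa>s. fst \<kappa>) = topspace M"

definition density_integral :: "'a chart list \<Rightarrow> ('a chart \<Rightarrow> real^3 \<Rightarrow> complex) \<Rightarrow> complex" where
  "density_integral \<kappa>s \<rho> =
     (\<Sum>i<length \<kappa>s.
        LINT x : snd (\<kappa>s ! i) ` (fst (\<kappa>s ! i) - (\<Union>j<i. fst (\<kappa>s ! j))) | lborel. \<rho> (\<kappa>s ! i) x)"

text \<open>\<open>\<sigma> \<kappa> x \<alpha>\<close> and \<open>B \<kappa> x\<close> are the coefficients of the operator in the chart \<open>\<kappa>\<close>: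
  \<open>A = -i \<sigma>\<^sup>\<alpha>(x) \<partial>/\<partial>x\<^sup>\<alpha> + B(x)\<close>, so that the principal symbol is \<open>\<sigma>\<^sup>\<alpha>(x) \<xi>\<^sub>\<alpha>\<close>.\<close>

definition first_order_operator ::
  "'a chart set \<Rightarrow> (('a chart \<Rightarrow> real^3 \<Rightarrow> complex^2) \<Rightarrow> ('a chart \<Rightarrow> real^3 \<Rightarrow> complex^2)) \<Rightarrow>
   ('a chart \<Rightarrow> real^3 \<Rightarrow> 3 \<Rightarrow> complex^2^2) \<Rightarrow> ('a chart \<Rightarrow> real^3 \<Rightarrow> complex^2^2) \<Rightarrow> bool" where
  "first_order_operator \<A> A \<sigma> B \<longleftrightarrow>
     (\<forall>\<kappa>\<in>\<A>. (\<forall>\<alpha>. smooth_on (chart_range \<kappa>) (\<lambda>x. \<sigma> \<kappa> x \<alpha>)) \<and> smooth_on (chart_range \<kappa>) (B \<kappa>)) \<and>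
     (\<forall>u\<in>half_density_columns \<A>. A u \<in> half_density_columns \<A> \<and>
        (\<forall>\<kappa>\<in>\<A>. \<forall>x\<in>chart_range \<kappa>.
           A u \<kappa> x =
             (- \<i>) *s (\<Sum>\<alpha>\<in>UNIV. \<sigma> \<kappa> x \<alpha> *v frechet_derivative (u \<kappa>) (at x) (axis \<alpha> 1))
             + B \<kappa> x *v u \<kappa> x))"

text \<open>Self-adjointness of a differential operator, as an identity on smooth half-densities.\<close>

definition self_adjoint_operator ::
  "'a topology \<Rightarrow> 'a chart set \<Rightarrow>
   (('a chart \<Rightarrow> real^3 \<Rightarrow> complex^2) \<Rightarrow> ('a chart \<Rightarrow> real^3 \<Rightarrow> complex^2)) \<Rightarrow> bool" where
  "self_adjoint_operator M \<A> A \<longleftrightarrow>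
     (\<forall>\<kappa>s u w. finite_chart_cover M \<A> \<kappa>s \<and>
        u \<in> half_density_columns \<A> \<and> w \<in> half_density_columns \<A> \<longrightarrow>
        density_integral \<kappa>s (\<lambda>\<kappa> x. hermitian_product (A u \<kappa> x) (w \<kappa> x)) =
        density_integral \<kappa>s (\<lambda>\<kappa> x. hermitian_product (u \<kappa> x) (A w \<kappa> x)))"

section \<open>Local objects determined by the principal symbol\<close>

text \<open>Below \<open>s\<close> stands for \<open>\<sigma> \<kappa>\<close>, the coefficients of the principal symbol in one chart.\<close>

definition principal_symbol :: "(real^3 \<Rightarrow> 3 \<Rightarrow> complex^2^2) \<Rightarrow> real^3 \<Rightarrow> real^3 \<Rightarrow> complex^2^2" where
  "principal_symbol s x \<xi> = (\<Sum>\<alpha>\<in>UNIV. \<xi> $ \<alpha> *\<^sub>R s x \<alpha>)"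

definition elliptic :: "'a chart set \<Rightarrow> ('a chart \<Rightarrow> real^3 \<Rightarrow> 3 \<Rightarrow> complex^2^2) \<Rightarrow> bool" where
  "elliptic \<A> \<sigma> \<longleftrightarrow>
     (\<forall>\<kappa>\<in>\<A>. \<forall>x\<in>chart_range \<kappa>. \<forall>\<xi>. \<xi> \<noteq> 0 \<longrightarrow> det (principal_symbol (\<sigma> \<kappa>) x \<xi>) \<noteq> 0)"

definition trace_free_symbol :: "'a chart set \<Rightarrow> ('a chart \<Rightarrow> real^3 \<Rightarrow> 3 \<Rightarrow> complex^2^2) \<Rightarrow> bool" where
  "trace_free_symbol \<A> \<sigma> \<longleftrightarrow>
     (\<forall>\<kappa>\<in>\<A>. \<forall>x\<in>chart_range \<kappa>. \<forall>\<xi>. trace (principal_symbol (\<sigma> \<kappa>) x \<xi>) = 0)"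

text \<open>\<open>inv_metric s x\<close> has the entries \<open>g\<^sup>\<alpha>\<^sup>\<beta>(x)\<close>, and \<open>metric s x\<close> the entries with lower indices.\<close>

definition inv_metric :: "(real^3 \<Rightarrow> 3 \<Rightarrow> complex^2^2) \<Rightarrow> real^3 \<Rightarrow> real^3^3" where
  "inv_metric s x = (THE G. transpose G = G \<and>
     (\<forall>\<xi>. det (principal_symbol s x \<xi>) =
        - complex_of_real (\<Sum>\<alpha>\<in>UNIV. \<Sum>\<beta>\<in>UNIV. G $ \<alpha> $ \<beta> * \<xi> $ \<alpha> * \<xi> $ \<beta>)))"

definition metric :: "(real^3 \<Rightarrow> 3 \<Rightarrow> complex^2^2) \<Rightarrow> real^3 \<Rightarrow> real^3^3" where
  "metric s x = matrix_inv (inv_metric s x)"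

text \<open>\<open>frame s x $ j $ \<alpha>\<close> is the component \<open>\<alpha>\<close> of the vector field \<open>V\<^sub>j\<close>.\<close>

definition frame :: "(real^3 \<Rightarrow> 3 \<Rightarrow> complex^2^2) \<Rightarrow> real^3 \<Rightarrow> real^3^3" where
  "frame s x = vector
     [\<chi> \<alpha>. Re (s x \<alpha> $ 1 $ 2),
      \<chi> \<alpha>. - Im (s x \<alpha> $ 1 $ 2),
      \<chi> \<alpha>. Re (s x \<alpha> $ 1 $ 1)]"

definition coframe :: "(real^3 \<Rightarrow> 3 \<Rightarrow> complex^2^2) \<Rightarrow> real^3 \<Rightarrow> real^3^3" where
  "coframe s x = (\<chi> k \<beta>. \<Sum>\<gamma>\<in>UNIV. metric s x $ \<beta> $ \<gamma> * frame s x $ k $ \<gamma>)"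

definition is_relative_orientation ::
  "'a chart set \<Rightarrow> ('a chart \<Rightarrow> real^3 \<Rightarrow> 3 \<Rightarrow> complex^2^2) \<Rightarrow> real \<Rightarrow> bool" where
  "is_relative_orientation \<O> \<sigma> c \<longleftrightarrow>
     (\<forall>\<kappa>\<in>\<O>. \<forall>x\<in>chart_range \<kappa>. c = sgn (det (frame (\<sigma> \<kappa>) x)))"

text \<open>\<open>teleparallel s x \<alpha> \<mu> \<beta>\<close> is the coefficient with upper index \<open>\<alpha>\<close> and lower indices
  \<open>\<mu>\<close>, \<open>\<beta>\<close>, where \<open>\<mu>\<close> is the direction of differentiation. The formula expresses that
  the fields \<open>V\<^sub>j\<close> are covariantly constant, i.e. that covectors with equal principal symbol at
  different points are parallel.\<close>

definition teleparallel :: "(real^3 \<Rightarrow> 3 \<Rightarrow> complex^2^2) \<Rightarrow> real^3 \<Rightarrow> 3 \<Rightarrow> 3 \<Rightarrow> 3 \<Rightarrow> real" where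
  "teleparallel s x \<alpha> \<mu> \<beta> =
     (\<Sum>k\<in>UNIV. frame s x $ k $ \<alpha> *
        frechet_derivative (\<lambda>y. coframe s y $ k $ \<beta>) (at x) (axis \<mu> 1))"

definition torsion :: "(real^3 \<Rightarrow> 3 \<Rightarrow> complex^2^2) \<Rightarrow> real^3 \<Rightarrow> 3 \<Rightarrow> 3 \<Rightarrow> 3 \<Rightarrow> real" where
  "torsion s x \<alpha> \<beta> \<gamma> = teleparallel s x \<alpha> \<beta> \<gamma> - teleparallel s x \<alpha> \<gamma> \<beta>"

definition torsion_raised :: "(real^3 \<Rightarrow> 3 \<Rightarrow> complex^2^2) \<Rightarrow> real^3 \<Rightarrow> 3 \<Rightarrow> 3 \<Rightarrow> 3 \<Rightarrow> real" where
  "torsion_raised s x \<alpha> \<gamma> \<delta> =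
     (\<Sum>\<mu>\<in>UNIV. \<Sum>\<nu>\<in>UNIV.
        inv_metric s x $ \<gamma> $ \<mu> * inv_metric s x $ \<delta> $ \<nu> * torsion s x \<alpha> \<mu> \<nu>)"

definition levi_civita :: "3 \<Rightarrow> 3 \<Rightarrow> 3 \<Rightarrow> real" where
  "levi_civita \<alpha> \<beta> \<gamma> =
     (if (\<alpha>, \<beta>, \<gamma>) \<in> {(1, 2, 3), (2, 3, 1), (3, 1, 2)} then 1
      else if (\<alpha>, \<beta>, \<gamma>) \<in> {(1, 3, 2), (3, 2, 1), (2, 1, 3)} then - 1
      else 0)"

definition dual_torsion :: "(real^3 \<Rightarrow> 3 \<Rightarrow> complex^2^2) \<Rightarrow> real^3 \<Rightarrow> 3 \<Rightarrow> 3 \<Rightarrow> real" where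
  "dual_torsion s x \<alpha> \<beta> =
     1 / 2 * (\<Sum>\<gamma>\<in>UNIV. \<Sum>\<delta>\<in>UNIV. torsion_raised s x \<alpha> \<gamma> \<delta> * levi_civita \<gamma> \<delta> \<beta>)
     * sqrt (det (metric s x))"

definition dual_torsion_raised :: "(real^3 \<Rightarrow> 3 \<Rightarrow> complex^2^2) \<Rightarrow> real^3 \<Rightarrow> 3 \<Rightarrow> 3 \<Rightarrow> real" where
  "dual_torsion_raised s x \<alpha> \<beta> =
     (\<Sum>\<gamma>\<in>UNIV. dual_torsion s x \<alpha> \<gamma> * inv_metric s x $ \<gamma> $ \<beta>)"

section \<open>Eigenvectors and Poisson brackets\<close>

definition local_positive_eigenvector ::
  "(real^3 \<Rightarrow> 3 \<Rightarrow> complex^2^2) \<Rightarrow> ((real^3) \<times> (real^3)) set \<Rightarrow>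
   ((real^3) \<times> (real^3) \<Rightarrow> complex^2) \<Rightarrow> bool" where
  "local_positive_eigenvector s W v \<longleftrightarrow> smooth_on W v \<and>
     (\<forall>(x, \<xi>)\<in>W. norm (v (x, \<xi>)) = 1 \<and>
        (\<exists>h>0. principal_symbol s x \<xi> *v v (x, \<xi>) = complex_of_real h *s v (x, \<xi>)))"

definition conj_row :: "('p \<Rightarrow> complex^2) \<Rightarrow> 'p \<Rightarrow> complex^2" where
  "conj_row v p = (\<chi> j. cnj (v p $ j))"

definition row_times_column :: "complex^2 \<Rightarrow> complex^2 \<Rightarrow> complex" where
  "row_times_column r w = (\<Sum>j\<in>UNIV. r $ j * w $ j)"

text \<open>The bracket of a row-valued \<open>P\<close> and a column-valued \<open>R\<close>, with factors in this order.\<close>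

definition poisson_bracket ::
  "((real^3) \<times> (real^3) \<Rightarrow> complex^2) \<Rightarrow> ((real^3) \<times> (real^3) \<Rightarrow> complex^2) \<Rightarrow>
   (real^3) \<times> (real^3) \<Rightarrow> complex" where
  "poisson_bracket P R p =
     (\<Sum>\<alpha>\<in>UNIV.
        row_times_column (frechet_derivative P (at p) (axis \<alpha> 1, 0))
                         (frechet_derivative R (at p) (0, axis \<alpha> 1))
      - row_times_column (frechet_derivative P (at p) (0, axis \<alpha> 1))
                         (frechet_derivative R (at p) (axis \<alpha> 1, 0)))"

end

theory Submission
  imports Defs
begin

text \<open>Testing self-adjointness on bump functions and taking the commutator with a coordinate function
  removes every derivative, so the symbol is seen to be Hermitian without integration by parts.
  With \<open>m\<^sub>j = V\<^sub>j\<^sup>\<alpha> \<xi>\<^sub>\<alpha>\<close> the symbol is then the Pauli matrix of the vector \<open>m\<close>, and the Bloch vector of \<open>v\<^sup>+\<close>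
  is \<open>n = m / |m|\<close>. The curvature form of the eigenvector line bundle is half the area form of the
  sphere, so the left-hand side equals \<open>1/2 |m|^(-3) \<Sum>\<^sub>\<alpha> m \<bullet> (m\<^sub>x \<times> m\<^sub>\<xi>)\<close>, the derivatives being taken with
  respect to \<open>x\<^sup>\<alpha>\<close> and \<open>\<xi>\<^sub>\<alpha>\<close>.
  Since \<open>m\<^sub>k(x, \<xi>)\<close> times the coframe returns the constant covector \<open>\<xi>\<close>, differentiating this identity turns
  the contraction of \<open>\<xi>\<close> with the connection coefficients into derivatives of \<open>m\<close>, which yields the same
  triple products on the torsion side.\<close>

section \<open>Calculus of smooth maps\<close>

text \<open>Neither the Hermitian property nor the transformation law of the symbol is assumed: the
  operator is known only through its action on global half-densities and through integrals of these.
  A coordinate is not a global function, so it is multiplied by a bump supported in one chart.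
  Extending the product by zero requires its compact support to be closed in \<open>M\<close>, which
  is where the Hausdorff property enters. The bracket formula is proved inside one chart. Global
  arguments return only for the constancy of \<open>c\<close>: the transformation law makes the sign
  of the frame determinant independent of the chart in \<open>\<O>\<close>, and connectedness does
  the rest. On the torsion side this sign compensates the absolute value in sqrt (det g) = 1 / |det
  V|. The phase of \<open>v\<close> does not matter because a change of phase multiplies all
  derivatives of \<open>v\<close> by a common phase and adds real multiples of \<open>i v\<close> to
  them. The latter change the products \<open>a\<^sup>* b\<close> of derivatives only by real
  numbers, while the bracket sees only their imaginary parts.\<close>

lemma frechet_derivative_transform:
  assumes "open S" "x \<in> S" "\<And>y. y \<in> S \<Longrightarrow> f y = g y"
  shows "frechet_derivative f (at x) = frechet_derivative g (at x)"
proof -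
  \<comment> \<open>\<open>frechet_derivative\<close> is a choice among all derivatives, so
    equivalent predicates yield equal choices even where no derivative exists.\<close>
  have "(f has_derivative D) (at x) \<longleftrightarrow> (g has_derivative D) (at x)" for D
    using has_derivative_transform_within_open[OF _ assms(1,2), of f D UNIV g]
      has_derivative_transform_within_open[OF _ assms(1,2), of g D UNIV f] assms(3) by auto
  then show ?thesis unfolding frechet_derivative_def by simp
qed

lemma differentiable_transform_open:
  assumes "f differentiable (at x)" "open S" "x \<in> S" "\<And>y. y \<in> S \<Longrightarrow> f y = g y"
  shows "g differentiable (at x)"
  using has_derivative_transform_within_open[OF _ assms(2,3), of f _ UNIV g] assms(1,4)
  unfolding differentiable_def by blast

lemma continuously_differentiable_on_cong:
  assumes "open S" "\<And>y. y \<in> S \<Longrightarrow> f y = g y"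
  shows "continuously_differentiable_on k S f \<longleftrightarrow> continuously_differentiable_on k S g"
  using assms(2)
proof (induction k arbitrary: f g)
  case 0
  then show ?case by (simp cong: continuous_on_cong)
next
  case (Suc k)
  have "frechet_derivative f (at x) = frechet_derivative g (at x)" if "x \<in> S" for x
    using frechet_derivative_transform[OF assms(1) that] Suc.prems by blast
  then have "continuously_differentiable_on k S (\<lambda>x. frechet_derivative f (at x) v) \<longleftrightarrow>
    continuously_differentiable_on k S (\<lambda>x. frechet_derivative g (at x) v)" for v
    by (intro Suc.IH) simp
  moreover have "f differentiable (at x) \<longleftrightarrow> g differentiable (at x)" if "x \<in> S" for x
    using differentiable_transform_open[OF _ assms(1) that] Suc.prems by metis
  ultimately show ?case by simp
qed

lemma continuously_differentiable_on_subset: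
  "continuously_differentiable_on k S f \<Longrightarrow> T \<subseteq> S \<Longrightarrow> continuously_differentiable_on k T f"
  by (induction k arbitrary: f) (auto intro: continuous_on_subset)

lemma continuously_differentiable_on_Suc:
  "continuously_differentiable_on (Suc k) S f \<Longrightarrow> continuously_differentiable_on k S f"
proof (induction k arbitrary: f)
  case 0
  then show ?case
    by (auto intro!: continuous_at_imp_continuous_on differentiable_imp_continuous_within)
next
  case (Suc k)
  then show ?case
    unfolding continuously_differentiable_on.simps(2)[of k S f]
      continuously_differentiable_on.simps(2)[of "Suc k" S f] by blast
qed

lemma continuously_differentiable_on_Un:
  assumes "open S" "open T"
    "continuously_differentiable_on k S f" "continuously_differentiable_on k T f"
  shows "continuously_differentiable_on k (S \<union> T) f"
  using assms(3,4) by (induction k arbitrary: f) (auto intro: continuous_on_open_Un assms)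

text \<open>Entry point for the inductions on the order: an explicit formula \<open>D\<close>
  replaces the choice operator \<open>frechet_derivative\<close>, so that the induction hypothesis
  meets concrete sums and products.\<close>

lemma continuously_differentiable_on_SucI:
  assumes "open S" "\<And>x. x \<in> S \<Longrightarrow> (f has_derivative D x) (at x)"
    "\<And>v. continuously_differentiable_on k S (\<lambda>x. D x v)"
  shows "continuously_differentiable_on (Suc k) S f"
proof -
  have "frechet_derivative f (at x) = D x" if "x \<in> S" for x
    using frechet_derivative_at[OF assms(2)[OF that]] by simp
  then have "continuously_differentiable_on k S (\<lambda>x. frechet_derivative f (at x) v)" for v
    using assms(3)[of v] by (subst continuously_differentiable_on_cong[OF assms(1), where g="\<lambda>x. D x v"]) auto
  then show ?thesis using assms(2) by (auto simp: differentiable_def)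
qed

lemma continuously_differentiable_on_has_derivative:
  assumes "continuously_differentiable_on (Suc k) S f" "x \<in> S"
  shows "(f has_derivative frechet_derivative f (at x)) (at x)"
  using assms by (simp add: frechet_derivative_works)

lemma continuously_differentiable_on_const:
  "open S \<Longrightarrow> continuously_differentiable_on k S (\<lambda>x. c)"
proof (induction k arbitrary: c)
  case (Suc k)
  show ?case by (rule continuously_differentiable_on_SucI[where D="\<lambda>_ _. 0"]) (use Suc in auto)
qed auto

lemma continuously_differentiable_on_bounded_linear:
  assumes "open S" "bounded_linear L" "continuously_differentiable_on k S f"
  shows "continuously_differentiable_on k S (\<lambda>x. L (f x))"
  using assms(3)
proof (induction k arbitrary: f)
  case 0
  then show ?case using assms(2) by (auto intro: bounded_linear.continuous_on)
next
  case (Suc k)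
  show ?case
  proof (rule continuously_differentiable_on_SucI[OF assms(1)])
    fix x assume "x \<in> S"
    then show "((\<lambda>x. L (f x)) has_derivative (\<lambda>v. L (frechet_derivative f (at x) v))) (at x)"
      by (intro bounded_linear.has_derivative[OF assms(2)]
          continuously_differentiable_on_has_derivative[OF Suc.prems])
  qed (use Suc in auto)
qed

lemma continuously_differentiable_on_add:
  assumes "open S" "continuously_differentiable_on k S f" "continuously_differentiable_on k S g"
  shows "continuously_differentiable_on k S (\<lambda>x. f x + g x)"
  using assms(2,3)
proof (induction k arbitrary: f g)
  case 0
  then show ?case by (auto intro: continuous_intros)
next
  case (Suc k)
  show ?case
  proof (rule continuously_differentiable_on_SucI[OF assms(1)])
    fix x assume "x \<in> S"
    then show "((\<lambda>x. f x + g x) has_derivative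
      (\<lambda>v. frechet_derivative f (at x) v + frechet_derivative g (at x) v)) (at x)"
      by (intro has_derivative_add continuously_differentiable_on_has_derivative[OF Suc.prems(1)]
          continuously_differentiable_on_has_derivative[OF Suc.prems(2)])
  qed (use Suc in auto)
qed

lemma continuously_differentiable_on_bounded_bilinear:
  assumes "open S" "bounded_bilinear B"
    "continuously_differentiable_on k S f" "continuously_differentiable_on k S g"
  shows "continuously_differentiable_on k S (\<lambda>x. B (f x) (g x))"
  using assms(3,4)
proof (induction k arbitrary: f g)
  case 0
  then show ?case using bounded_bilinear.continuous_on[OF assms(2)] by auto
next
  case (Suc k)
  note * = Suc.prems[THEN continuously_differentiable_on_Suc]
  show ?case
  proof (rule continuously_differentiable_on_SucI[OF assms(1)])
    fix x assume "x \<in> S"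
    then show "((\<lambda>x. B (f x) (g x)) has_derivative
      (\<lambda>v. B (f x) (frechet_derivative g (at x) v) + B (frechet_derivative f (at x) v) (g x))) (at x)"
      by (intro bounded_bilinear.FDERIV[OF assms(2)]
          continuously_differentiable_on_has_derivative[OF Suc.prems(1)]
          continuously_differentiable_on_has_derivative[OF Suc.prems(2)])
  next
    fix v
    show "continuously_differentiable_on k S
      (\<lambda>x. B (f x) (frechet_derivative g (at x) v) + B (frechet_derivative f (at x) v) (g x))"
      using Suc * by (intro continuously_differentiable_on_add[OF assms(1)] Suc.IH) auto
  qed
qed

lemma continuously_differentiable_on_sum:
  assumes "open S" "\<And>i. i \<in> I \<Longrightarrow> continuously_differentiable_on k S (f i)"
  shows "continuously_differentiable_on k S (\<lambda>x. \<Sum>i\<in>I. f i x)"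
  using assms(2)
  by (induction I rule: infinite_finite_induct)
    (auto intro!: continuously_differentiable_on_add continuously_differentiable_on_const assms(1))

text \<open>The order of differentiability is defined through derivatives in fixed directions,
  whereas the chain rule evaluates the derivative of \<open>g\<close> in a direction that varies
  with \<open>x\<close>. Expanding this direction in a basis turns the derivative into a finite sum
  of products to which the induction hypothesis applies; hence the middle space is
  Euclidean.\<close>

lemma continuously_differentiable_on_compose:
  fixes f :: "'b::real_normed_vector \<Rightarrow> 'c::euclidean_space"
  assumes "open S" "open T" "f ` S \<subseteq> T"
    "continuously_differentiable_on k S f" "continuously_differentiable_on k T g"
  shows "continuously_differentiable_on k S (\<lambda>x. g (f x))"
  using assms(4,5)
proof (induction k arbitrary: g)
  case 0
  then show ?case using assms(3) by (auto intro: continuous_on_compose2)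
next
  case (Suc k)
  have g: "(g has_derivative frechet_derivative g (at (f x))) (at (f x))" if "x \<in> S" for x
    using continuously_differentiable_on_has_derivative[OF Suc.prems(2)] assms(3) that by blast
  show ?case
  proof (rule continuously_differentiable_on_SucI[OF assms(1)])
    fix x assume x: "x \<in> S"
    let ?D = "frechet_derivative g (at (f x))" and ?F = "frechet_derivative f (at x)"
    have "((\<lambda>x. g (f x)) has_derivative (\<lambda>v. ?D (?F v))) (at x)"
      using diff_chain_at[OF continuously_differentiable_on_has_derivative[OF Suc.prems(1) x] g[OF x]]
      by (simp add: o_def)
    moreover have "?D w = (\<Sum>b\<in>Basis. (w \<bullet> b) *\<^sub>R ?D b)" for w
    proof -
      have lin: "linear ?D" using has_derivative_linear[OF g[OF x]] .
      have "?D w = ?D (\<Sum>b\<in>Basis. (w \<bullet> b) *\<^sub>R b)" by (simp only: euclidean_representation)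
      also have "\<dots> = (\<Sum>b\<in>Basis. (w \<bullet> b) *\<^sub>R ?D b)"
        by (simp only: linear_sum[OF lin] linear_cmul[OF lin])
      finally show ?thesis .
    qed
    ultimately show "((\<lambda>x. g (f x)) has_derivative
      (\<lambda>v. \<Sum>b\<in>Basis. (?F v \<bullet> b) *\<^sub>R ?D b)) (at x)"
      by (metis (no_types, lifting) ext)
  next
    fix v
    show "continuously_differentiable_on k S
      (\<lambda>x. \<Sum>b\<in>Basis. (frechet_derivative f (at x) v \<bullet> b) *\<^sub>R frechet_derivative g (at (f x)) b)"
    proof (intro continuously_differentiable_on_sum[OF assms(1)]
        continuously_differentiable_on_bounded_bilinear[OF assms(1) bounded_bilinear_scaleR])
      fix b :: 'c
      show "continuously_differentiable_on k S (\<lambda>x. frechet_derivative f (at x) v \<bullet> b)"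
        using Suc.prems(1)
        by (intro continuously_differentiable_on_bounded_linear[OF assms(1) bounded_linear_inner_left]) simp
      show "continuously_differentiable_on k S (\<lambda>x. frechet_derivative g (at (f x)) b)"
        using Suc.prems by (intro Suc.IH continuously_differentiable_on_Suc[OF Suc.prems(1)]) simp
    qed
  qed
qed

section \<open>Closure properties of smooth maps\<close>

lemma smooth_onI: "(\<And>k. continuously_differentiable_on k S f) \<Longrightarrow> smooth_on S f"
  by (simp add: smooth_on_def)

lemma smooth_onD: "smooth_on S f \<Longrightarrow> continuously_differentiable_on k S f"
  by (simp add: smooth_on_def)

lemma smooth_onD_has_derivative:
  assumes "smooth_on S f" "x \<in> S"
  shows "(f has_derivative frechet_derivative f (at x)) (at x)"
  by (rule continuously_differentiable_on_has_derivative[OF smooth_onD[OF assms(1)] assms(2)])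

lemma smooth_on_imp_continuous_on: "smooth_on S f \<Longrightarrow> continuous_on S f"
  using smooth_onD[of S f 0] by simp

lemma smooth_on_cong:
  assumes "open S" "\<And>y. y \<in> S \<Longrightarrow> f y = g y"
  shows "smooth_on S f \<longleftrightarrow> smooth_on S g"
  unfolding smooth_on_def using continuously_differentiable_on_cong[OF assms] by simp

lemma smooth_on_subset:
  assumes "smooth_on S f" "T \<subseteq> S"
  shows "smooth_on T f"
  by (rule smooth_onI continuously_differentiable_on_subset[OF smooth_onD[OF assms(1)] assms(2)])+

lemma smooth_on_Un:
  assumes "open S" "open T" "smooth_on S f" "smooth_on T f"
  shows "smooth_on (S \<union> T) f"
  using assms by (simp add: smooth_on_def continuously_differentiable_on_Un)

lemma smooth_on_const: "open S \<Longrightarrow> smooth_on S (\<lambda>x. c)"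
  by (simp add: smooth_on_def continuously_differentiable_on_const)

lemma smooth_on_id:
  assumes "open S"
  shows "smooth_on S (\<lambda>x. x)"
proof (rule smooth_onI)
  fix k
  show "continuously_differentiable_on k S (\<lambda>x. x)"
  proof (cases k)
    case (Suc n)
    then show ?thesis
      by (auto simp del: continuously_differentiable_on.simps(2) intro: assms has_derivative_ident
          continuously_differentiable_on_const continuously_differentiable_on_SucI[where D="\<lambda>_ v. v"])
  qed simp
qed

lemma smooth_on_bounded_linear_compose:
  assumes "open S" "bounded_linear L" "smooth_on S f"
  shows "smooth_on S (\<lambda>x. L (f x))"
  by (rule smooth_onI continuously_differentiable_on_bounded_linear[OF assms(1,2) smooth_onD[OF assms(3)]])+

lemma smooth_on_add:
  assumes "open S" "smooth_on S f" "smooth_on S g"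
  shows "smooth_on S (\<lambda>x. f x + g x)"
  by (rule smooth_onI continuously_differentiable_on_add[OF assms(1) assms(2,3)[THEN smooth_onD]])+

lemma smooth_on_minus:
  assumes "open S" "smooth_on S f"
  shows "smooth_on S (\<lambda>x. - f x)"
  by (rule smooth_on_bounded_linear_compose[OF assms(1) bounded_linear_minus[OF bounded_linear_ident] assms(2)])

lemma smooth_on_diff:
  assumes "open S" "smooth_on S f" "smooth_on S g"
  shows "smooth_on S (\<lambda>x. f x - g x)"
  using smooth_on_add[OF assms(1,2) smooth_on_minus[OF assms(1,3)]] by simp

lemma smooth_on_bounded_bilinear:
  assumes "open S" "bounded_bilinear B" "smooth_on S f" "smooth_on S g"
  shows "smooth_on S (\<lambda>x. B (f x) (g x))"
  by (rule smooth_onI continuously_differentiable_on_bounded_bilinear[OF assms(1,2)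
        assms(3,4)[THEN smooth_onD]])+

lemmas smooth_on_scaleR = smooth_on_bounded_bilinear[OF _ bounded_bilinear_scaleR]
lemmas smooth_on_mult = smooth_on_bounded_bilinear[OF _ bounded_bilinear_mult]
lemmas smooth_on_inner = smooth_on_bounded_bilinear[OF _ bounded_bilinear_inner]

lemma smooth_on_compose:
  fixes f :: "'b::real_normed_vector \<Rightarrow> 'c::euclidean_space"
  assumes "open S" "open T" "f ` S \<subseteq> T" "smooth_on S f" "smooth_on T g"
  shows "smooth_on S (\<lambda>x. g (f x))"
  by (rule smooth_onI continuously_differentiable_on_compose[OF assms(1-3)
        assms(4,5)[THEN smooth_onD]])+

lemma smooth_on_frechet_derivative:
  assumes "smooth_on S f"
  shows "smooth_on S (\<lambda>x. frechet_derivative f (at x) v)"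
  using smooth_onD[OF assms, of "Suc _"] by (intro smooth_onI) simp

lemma smooth_on_nth:
  assumes "open S" "smooth_on S f"
  shows "smooth_on S (\<lambda>x. f x $ i)"
  by (rule smooth_on_bounded_linear_compose[OF assms(1) bounded_linear_vec_nth assms(2)])

text \<open>The derivative is a polynomial in the function itself and a derivative of
  \<open>f\<close>, so the order can be raised by induction.\<close>

lemma smooth_on_inverse:
  fixes f :: "'b::real_normed_vector \<Rightarrow> real"
  assumes "open S" "smooth_on S f" "\<And>x. x \<in> S \<Longrightarrow> f x \<noteq> 0"
  shows "smooth_on S (\<lambda>x. inverse (f x))"
  unfolding smooth_on_def
proof
  fix k
  show "continuously_differentiable_on k S (\<lambda>x. inverse (f x))"
  proof (induction k)
    case 0
    show ?case using smooth_on_imp_continuous_on[OF assms(2)] assms(3)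
      by (auto intro: continuous_intros)
  next
    case (Suc k)
    show ?case
    proof (rule continuously_differentiable_on_SucI[OF assms(1)])
      fix x assume "x \<in> S"
      then show "((\<lambda>x. inverse (f x)) has_derivative
        (\<lambda>v. - (inverse (f x) * frechet_derivative f (at x) v * inverse (f x)))) (at x)"
        using assms(3) by (intro Deriv.has_derivative_inverse smooth_onD_has_derivative[OF assms(2)]) auto
    next
      fix v
      have "continuously_differentiable_on k S (\<lambda>x. frechet_derivative f (at x) v)"
        using smooth_on_frechet_derivative[OF assms(2)] unfolding smooth_on_def by blast
      then show "continuously_differentiable_on k S
          (\<lambda>x. - (inverse (f x) * frechet_derivative f (at x) v * inverse (f x)))"
        using Suc by (intro continuously_differentiable_on_bounded_linear[OF assms(1)
              bounded_linear_minus[OF bounded_linear_ident]]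
            continuously_differentiable_on_bounded_bilinear[OF assms(1) bounded_bilinear_mult])
    qed
  qed
qed

text \<open>Here too the derivative is written through the function itself, as half of
  \<open>sqrt \<bar>f x\<bar> * inverse (f x)\<close> times the derivative of \<open>f\<close>. This
  form is the same for both signs of \<open>f\<close>, as is required for the weight of
  half-densities under arbitrary coordinate changes.\<close>

lemma smooth_on_sqrt_abs:
  fixes f :: "'b::real_normed_vector \<Rightarrow> real"
  assumes "open S" "smooth_on S f" "\<And>x. x \<in> S \<Longrightarrow> f x \<noteq> 0"
  shows "smooth_on S (\<lambda>x. sqrt \<bar>f x\<bar>)"
  unfolding smooth_on_def
proof
  fix k
  show "continuously_differentiable_on k S (\<lambda>x. sqrt \<bar>f x\<bar>)"
  proof (induction k)
    case 0
    show ?case using smooth_on_imp_continuous_on[OF assms(2)] assms(3)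
      by (auto intro: continuous_intros)
  next
    case (Suc k)
    show ?case
    proof (rule continuously_differentiable_on_SucI[OF assms(1)])
      fix x assume x: "x \<in> S"
      have D: "(f has_derivative frechet_derivative f (at x)) (at x)"
        using smooth_onD_has_derivative[OF assms(2) x] .
      have "((\<lambda>t. sqrt \<bar>t\<bar>) has_field_derivative 1/2 * (sqrt \<bar>f x\<bar> * inverse (f x))) (at (f x))"
      proof (cases "f x > 0")
        case True
        have "(sqrt has_field_derivative inverse (sqrt (f x)) / 2) (at (f x))"
          using DERIV_real_sqrt[OF True] .
        then have "(sqrt has_field_derivative 1/2 * (sqrt \<bar>f x\<bar> * inverse (f x))) (at (f x))"
          using True by (simp add: sqrt_divide_self_eq divide_inverse[symmetric] inverse_eq_divide mult.commute)
        then show ?thesis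
          by (rule has_field_derivative_transform_within_open[where S="{0<..}"]) (use True in auto)
      next
        case False
        with assms(3)[OF x] have neg: "f x < 0" by simp
        have "(sqrt has_field_derivative inverse (sqrt (- f x)) / 2) (at (- f x))"
          using DERIV_real_sqrt[of "- f x"] neg by simp
        then have "((\<lambda>t. sqrt (- t)) has_field_derivative inverse (sqrt (- f x)) / 2 * (-1)) (at (f x))"
          by (rule DERIV_chain2) (auto intro!: derivative_eq_intros)
        moreover have "inverse (sqrt (- f x)) / 2 * (-1) = 1/2 * (sqrt \<bar>f x\<bar> * inverse (f x))"
        proof -
          have "sqrt (- f x) * sqrt (- f x) = - f x" using neg by simp
          moreover have "sqrt (- f x) \<noteq> 0" using neg by simp
          ultimately show ?thesis using neg by (simp add: field_simps)
        qed
        ultimately have "((\<lambda>t. sqrt (- t)) has_field_derivative 1/2 * (sqrt \<bar>f x\<bar> * inverse (f x))) (at (f x))"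
          by (simp only:)
        then show ?thesis
          by (rule has_field_derivative_transform_within_open[where S="{..<0}"]) (use neg in auto)
      qed
      from diff_chain_at[OF D this[unfolded has_field_derivative_def]]
      show "((\<lambda>x. sqrt \<bar>f x\<bar>) has_derivative
        (\<lambda>v. 1/2 * (sqrt \<bar>f x\<bar> * inverse (f x)) * frechet_derivative f (at x) v)) (at x)"
        by (simp add: o_def)
    next
      fix v
      have "continuously_differentiable_on k S (\<lambda>x. frechet_derivative f (at x) v)"
        "continuously_differentiable_on k S (\<lambda>x. inverse (f x))"
        using smooth_on_frechet_derivative[OF assms(2)] smooth_on_inverse[OF assms]
        unfolding smooth_on_def by blast+
      then show "continuously_differentiable_on k S
          (\<lambda>x. 1/2 * (sqrt \<bar>f x\<bar> * inverse (f x)) * frechet_derivative f (at x) v)"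
        using Suc by (intro continuously_differentiable_on_bounded_bilinear[OF assms(1) bounded_bilinear_mult]
            continuously_differentiable_on_const[OF assms(1)])
    qed
  qed
qed

section \<open>Bump functions\<close>

text \<open>The exponent \<open>n\<close> makes the family closed under differentiation up to linear combinations.\<close>

definition exp_bump :: "nat \<Rightarrow> real \<Rightarrow> real" where
  "exp_bump n t = (if t > 0 then inverse t ^ n * exp (- inverse t) else 0)"

text \<open>Substituting 1/t turns the limit from the right into the decay of t^n / exp t at
  infinity; from the left the function vanishes.\<close>

lemma exp_bump_tendsto: "(exp_bump n \<longlongrightarrow> 0) (at 0)"
proof -
  have "((\<lambda>t::real. t ^ n / exp t) \<longlongrightarrow> 0) at_top" by (rule tendsto_power_div_exp_0)
  then have "((\<lambda>t::real. inverse t ^ n / exp (inverse t)) \<longlongrightarrow> 0) (at_right 0)"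
    by (rule filterlim_compose) (rule filterlim_inverse_at_top_right)
  then have r: "(exp_bump n \<longlongrightarrow> 0) (at_right 0)"
    by (rule Lim_transform_eventually)
      (auto simp: exp_bump_def exp_minus divide_inverse eventually_at_right_field intro!: exI[of _ 1])
  have l: "(exp_bump n \<longlongrightarrow> 0) (at_left 0)"
    by (rule Lim_transform_eventually[OF tendsto_const])
      (auto simp: exp_bump_def eventually_at_left_field intro!: exI[of _ "-1"])
  show ?thesis using l r filterlim_split_at by blast
qed

lemma exp_bump_has_derivative:
  "(exp_bump n has_field_derivative (exp_bump (n + 2) t - n * exp_bump (n + 1) t)) (at t)"
proof -
  consider "t > 0" | "t < 0" | "t = 0" by linarith
  then show ?thesis
  proof cases
    case 1
    have power_eq: "m = 0 \<or> inverse t ^ m = inverse t * inverse t ^ (m - Suc 0)" for m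
      by (cases m) auto
    have "((\<lambda>t. inverse t ^ n * exp (- inverse t)) has_field_derivative
      (exp_bump (n + 2) t - n * exp_bump (n + 1) t)) (at t)"
      using 1 power_eq by (cases n) (auto intro!: derivative_eq_intros simp: exp_bump_def power2_eq_square algebra_simps)
    then show ?thesis
      by (rule has_field_derivative_transform_within_open[where S="{0<..}"]) (use 1 in \<open>auto simp: exp_bump_def\<close>)
  next
    case 2
    have "((\<lambda>t. 0) has_field_derivative (exp_bump (n + 2) t - n * exp_bump (n + 1) t)) (at t)"
      using 2 by (simp add: exp_bump_def)
    then show ?thesis
      by (rule has_field_derivative_transform_within_open[where S="{..<0}"]) (use 2 in \<open>auto simp: exp_bump_def\<close>)
  next
    case 3
    \<comment> \<open>At 0 the difference quotient of \<open>exp_bump n\<close> is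
      \<open>exp_bump (n + 1)\<close> itself, whose limit is known.\<close>
    have "((\<lambda>y. (exp_bump n y - exp_bump n 0) / (y - 0)) \<longlongrightarrow> 0) (at 0)"
      by (rule Lim_transform_eventually[OF exp_bump_tendsto[of "n+1"]])
        (auto simp: exp_bump_def divide_inverse eventually_at intro!: exI[of _ 1])
    then show ?thesis using 3 by (simp add: has_field_derivative_iff exp_bump_def)
  qed
qed

lemma smooth_on_exp_bump: "smooth_on UNIV (exp_bump n)"
  unfolding smooth_on_def
proof
  fix k
  show "continuously_differentiable_on k UNIV (exp_bump n)"
  proof (induction k arbitrary: n)
    case 0
    show ?case 
      by (auto intro!: continuous_at_imp_continuous_on DERIV_isCont exp_bump_has_derivative)
  next
    case (Suc k)
    have "continuously_differentiable_on k UNIV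
        (\<lambda>x. (exp_bump (n + 2) x + (- real n) * exp_bump (n + 1) x) * v)" for v
      by (intro continuously_differentiable_on_bounded_bilinear[OF _ bounded_bilinear_mult]
          continuously_differentiable_on_add continuously_differentiable_on_const Suc.IH) auto
    then show ?case
      by (intro continuously_differentiable_on_SucI[OF _ exp_bump_has_derivative[unfolded has_field_derivative_def]])
        auto
  qed
qed

text \<open>The squared distance, unlike the distance, is smooth at the centre.\<close>

definition ball_bump :: "'b::euclidean_space \<Rightarrow> real \<Rightarrow> 'b \<Rightarrow> real" where
  "ball_bump c r x = exp_bump 0 (r\<^sup>2 - (x - c) \<bullet> (x - c))"

lemma smooth_on_ball_bump: "smooth_on UNIV (ball_bump c r)"
  unfolding ball_bump_def[abs_def]
  by (rule smooth_on_compose[OF _ open_UNIV _ _ smooth_on_exp_bump])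
    (auto intro!: smooth_on_diff smooth_on_inner smooth_on_const smooth_on_id)

lemma ball_bump_eq_0_iff:
  assumes "r > 0"
  shows "ball_bump c r x = 0 \<longleftrightarrow> x \<notin> ball c r"
proof -
  have "r\<^sup>2 - (x - c) \<bullet> (x - c) > 0 \<longleftrightarrow> norm (x - c) < r"
    using assms abs_le_square_iff[of r "norm (x - c)"]
    by (simp add: not_le[symmetric] power2_norm_eq_inner)
  then show ?thesis by (simp add: ball_bump_def exp_bump_def dist_norm norm_minus_commute)
qed

section \<open>Charts and half-densities\<close>

lemma is_chart_inj_on: "is_chart M \<kappa> \<Longrightarrow> inj_on (snd \<kappa>) (fst \<kappa>)"
  unfolding is_chart_def homeomorphic_map_def using openin_subset by (fastforce simp: inf_absorb2)

lemma is_chart_openin: "is_chart M \<kappa> \<Longrightarrow> openin M (fst \<kappa>)"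
  by (simp add: is_chart_def)

lemma is_chart_open_range: "is_chart M \<kappa> \<Longrightarrow> open (chart_range \<kappa>)"
  by (simp add: is_chart_def)

lemma is_chart_open_image:
  assumes "is_chart M \<kappa>" "openin M U"
  shows "open (snd \<kappa> ` (fst \<kappa> \<inter> U))"
proof -
  have "open_map (subtopology M (fst \<kappa>)) (top_of_set (chart_range \<kappa>)) (snd \<kappa>)"
    using assms(1) homeomorphic_imp_open_map unfolding is_chart_def by blast
  moreover have "openin (subtopology M (fst \<kappa>)) (fst \<kappa> \<inter> U)"
    using assms(2) by (metis inf_commute openin_subtopology)
  ultimately have "openin (top_of_set (chart_range \<kappa>)) (snd \<kappa> ` (fst \<kappa> \<inter> U))"
    unfolding open_map_def by blast
  then show ?thesis
    using is_chart_open_range[OF assms(1)] openin_open_eq by blast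
qed

lemma is_chart_openin_vimage:
  assumes "is_chart M \<kappa>" "open T"
  shows "openin M {p \<in> fst \<kappa>. snd \<kappa> p \<in> T}"
proof -
  have "continuous_map (subtopology M (fst \<kappa>)) (top_of_set (chart_range \<kappa>)) (snd \<kappa>)"
    using assms(1) homeomorphic_imp_continuous_map unfolding is_chart_def by blast
  from openin_continuous_map_preimage[OF this, of "chart_range \<kappa> \<inter> T"]
  have "openin (subtopology M (fst \<kappa>))
     {p \<in> topspace (subtopology M (fst \<kappa>)). snd \<kappa> p \<in> chart_range \<kappa> \<inter> T}"
    using assms(2) by auto
  moreover have "{p \<in> topspace (subtopology M (fst \<kappa>)). snd \<kappa> p \<in> chart_range \<kappa> \<inter> T}
      = {p \<in> fst \<kappa>. snd \<kappa> p \<in> T}"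
    using openin_subset[OF is_chart_openin[OF assms(1)]] by (auto simp: chart_range_def)
  ultimately show ?thesis
    using openin_trans_full[OF _ is_chart_openin[OF assms(1)]] by simp
qed

text \<open>Compactness is carried back by the chart and does not depend on the ambient space, and
  compact sets in a Hausdorff space are closed. Hence the complement of such a support is open, as
  extension by zero demands.\<close>

lemma is_chart_closedin_vimage:
  assumes "is_chart M \<kappa>" "Hausdorff_space M" "compact K" "K \<subseteq> chart_range \<kappa>"
  shows "closedin M {p \<in> fst \<kappa>. snd \<kappa> p \<in> K}"
proof -
  let ?P = "{p \<in> fst \<kappa>. snd \<kappa> p \<in> K}"
  have "snd \<kappa> ` ?P = K" using assms(4) by (auto simp: chart_range_def)
  then have "compactin (subtopology M (fst \<kappa>)) ?P"
    using assms homeomorphic_map_compactness_eq[of "subtopology M (fst \<kappa>)"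
        "top_of_set (chart_range \<kappa>)" "snd \<kappa>" ?P] openin_subset[of M "fst \<kappa>"]
    unfolding is_chart_def by (auto simp: compactin_subtopology)
  then have "compactin M ?P" by (simp add: compactin_subtopology)
  then show ?thesis using assms(2) compactin_imp_closedin by blast
qed

lemma transition_apply:
  assumes "is_chart M \<kappa>" "p \<in> fst \<kappa>"
  shows "transition \<kappa> \<kappa>' (snd \<kappa> p) = snd \<kappa>' p"
  unfolding transition_def using inv_into_f_f[OF is_chart_inj_on[OF assms(1)] assms(2)] by simp

lemma jacobian_nth: "jacobian f (at x) $ i $ j = frechet_derivative f (at x) (axis j 1) $ i"
  by (simp add: jacobian_def matrix_def)

lemma smooth_on_det_3:
  fixes X :: "'b::real_normed_vector \<Rightarrow> real^3^3"
  assumes "open S" "\<And>i j. smooth_on S (\<lambda>x. X x $ i $ j)"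
  shows "smooth_on S (\<lambda>x. det (X x))"
  unfolding det_3 by (intro smooth_on_add smooth_on_diff smooth_on_mult assms)

lemma smooth_on_det_jacobian:
  fixes f :: "real^3 \<Rightarrow> real^3"
  assumes "open S" "smooth_on S f"
  shows "smooth_on S (\<lambda>x. det (jacobian f (at x)))"
proof -
  have "smooth_on S (\<lambda>x. jacobian f (at x) $ i $ j)" for i j
    unfolding jacobian_nth
    by (rule smooth_on_nth[OF assms(1) smooth_on_frechet_derivative[OF assms(2)]])
  then show ?thesis by (rule smooth_on_det_3[OF assms(1)])
qed

lemma jacobian_compose:
  fixes f :: "real^'n \<Rightarrow> real^'m" and g :: "real^'m \<Rightarrow> real^'k"
  assumes "f differentiable (at x)" "g differentiable (at (f x))"
    "open S" "x \<in> S" "\<And>y. y \<in> S \<Longrightarrow> h y = g (f y)"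
  shows "jacobian h (at x) = jacobian g (at (f x)) ** jacobian f (at x)"
proof -
  have f: "(f has_derivative frechet_derivative f (at x)) (at x)"
    and g: "(g has_derivative frechet_derivative g (at (f x))) (at (f x))"
    using assms(1,2) frechet_derivative_works by blast+
  have "frechet_derivative h (at x) = frechet_derivative (g \<circ> f) (at x)"
    using assms by (intro frechet_derivative_transform[OF assms(3,4)]) auto
  also have "\<dots> = frechet_derivative g (at (f x)) \<circ> frechet_derivative f (at x)"
    using frechet_derivative_at[OF diff_chain_at[OF f g]] by simp
  finally show ?thesis
    unfolding jacobian_def
    by (simp add: matrix_compose has_derivative_linear[OF f] has_derivative_linear[OF g])
qed

text \<open>The weight is the one forced by the transformation law of half-densities. The extension
  by zero is smooth when the support of \<open>g\<close> is a compact part of the range of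
  \<open>\<kappa>\<close>.\<close>

definition extend_half_density ::
  "'a chart \<Rightarrow> (real^3 \<Rightarrow> complex^2) \<Rightarrow> 'a chart \<Rightarrow> real^3 \<Rightarrow> complex^2" where
  "extend_half_density \<kappa> g \<kappa>' y =
     (if y \<in> overlap \<kappa>' \<kappa>
      then sqrt \<bar>det (jacobian (transition \<kappa>' \<kappa>) (at y))\<bar> *\<^sub>R g (transition \<kappa>' \<kappa> y) else 0)"

lemma smooth_on_coordinate: "smooth_on UNIV (\<lambda>x::real^3. x $ \<beta>)"
  by (rule smooth_on_nth[OF open_UNIV smooth_on_id[OF open_UNIV]])

lemma frechet_derivative_coordinate:
  "frechet_derivative (\<lambda>x::real^3. x $ \<beta>) (at x) (axis \<alpha> 1) = (if \<alpha> = \<beta> then 1 else 0)"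
proof -
  have "((\<lambda>x::real^3. x $ \<beta>) has_derivative (\<lambda>x. x $ \<beta>)) (at x)"
    by (rule bounded_linear.has_derivative[OF bounded_linear_vec_nth has_derivative_ident])
  then show ?thesis using frechet_derivative_at[of "\<lambda>x::real^3. x $ \<beta>" "\<lambda>x. x $ \<beta>" x] by (simp add: axis_def)
qed

section \<open>Coordinate changes, and half-densities supported in one chart\<close>

locale manifold =
  fixes M :: "'a topology" and \<A> :: "'a chart set"
  assumes smooth_manifold: "smooth_manifold M \<A>"
begin

lemma Hausdorff: "Hausdorff_space M"
  using smooth_manifold by (simp add: smooth_manifold_def)

lemma is_chart: "\<kappa> \<in> \<A> \<Longrightarrow> is_chart M \<kappa>"
  using smooth_manifold by (simp add: smooth_manifold_def smooth_atlas_def)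

lemma charts_cover: "(\<Union>\<kappa>\<in>\<A>. fst \<kappa>) = topspace M"
  using smooth_manifold by (simp add: smooth_manifold_def smooth_atlas_def)

lemma smooth_transition:
  "\<kappa> \<in> \<A> \<Longrightarrow> \<kappa>' \<in> \<A> \<Longrightarrow> smooth_on (overlap \<kappa> \<kappa>') (transition \<kappa> \<kappa>')"
  using smooth_manifold by (simp add: smooth_manifold_def smooth_atlas_def compatible_def)

lemma open_chart_range: "\<kappa> \<in> \<A> \<Longrightarrow> open (chart_range \<kappa>)"
  using is_chart is_chart_open_range by blast

lemma open_overlap: "\<kappa> \<in> \<A> \<Longrightarrow> \<kappa>' \<in> \<A> \<Longrightarrow> open (overlap \<kappa> \<kappa>')"
  unfolding overlap_def using is_chart_open_image[OF is_chart is_chart_openin[OF is_chart]] .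

lemma transition_differentiable:
  assumes "\<kappa> \<in> \<A>" "\<kappa>' \<in> \<A>" "p \<in> fst \<kappa> \<inter> fst \<kappa>'"
  shows "transition \<kappa> \<kappa>' differentiable (at (snd \<kappa> p))"
  using smooth_onD_has_derivative[OF smooth_transition[OF assms(1,2)], of "snd \<kappa> p"] assms(3)
  unfolding differentiable_def overlap_def by blast

text \<open>The cocycle rule of coordinate changes. It is stated at a point of the manifold because
  each chart gives this point other coordinates.\<close>

lemma jacobian_transition_compose:
  assumes "\<kappa> \<in> \<A>" "\<kappa>' \<in> \<A>" "\<kappa>'' \<in> \<A>" "p \<in> fst \<kappa> \<inter> fst \<kappa>' \<inter> fst \<kappa>''"
  shows "jacobian (transition \<kappa> \<kappa>'') (at (snd \<kappa> p)) =
    jacobian (transition \<kappa>' \<kappa>'') (at (snd \<kappa>' p)) ** jacobian (transition \<kappa> \<kappa>') (at (snd \<kappa> p))"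
proof -
  let ?S = "snd \<kappa> ` (fst \<kappa> \<inter> (fst \<kappa>' \<inter> fst \<kappa>''))"
  have "transition \<kappa> \<kappa>' (snd \<kappa> p) = snd \<kappa>' p"
    using transition_apply[OF is_chart[OF assms(1)]] assms(4) by blast
  moreover have "open ?S"
    using is_chart_open_image[OF is_chart[OF assms(1)]] is_chart_openin[OF is_chart] assms by blast
  moreover have "transition \<kappa> \<kappa>'' y = transition \<kappa>' \<kappa>'' (transition \<kappa> \<kappa>' y)" if "y \<in> ?S" for y
    using that transition_apply[OF is_chart[OF assms(1)], of _ \<kappa>'] transition_apply[OF is_chart[OF assms(1)], of _ \<kappa>'']
      transition_apply[OF is_chart[OF assms(2)], of _ \<kappa>''] by auto
  ultimately show ?thesis
    using jacobian_compose[of "transition \<kappa> \<kappa>'" "snd \<kappa> p" "transition \<kappa>' \<kappa>''" ?S "transition \<kappa> \<kappa>''"]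
      transition_differentiable assms by auto
qed

lemma jacobian_transition_self:
  assumes "\<kappa> \<in> \<A>" "p \<in> fst \<kappa>"
  shows "jacobian (transition \<kappa> \<kappa>) (at (snd \<kappa> p)) = mat 1"
proof -
  have "transition \<kappa> \<kappa> y = id y" if "y \<in> chart_range \<kappa>" for y
    using that transition_apply[OF is_chart[OF assms(1)], of _ \<kappa>] by (auto simp: chart_range_def)
  then have "frechet_derivative (transition \<kappa> \<kappa>) (at (snd \<kappa> p)) = frechet_derivative id (at (snd \<kappa> p))"
    using assms by (intro frechet_derivative_transform[OF open_chart_range[OF assms(1)]])
      (auto simp: chart_range_def)
  also have "\<dots> = id" using frechet_derivative_at[OF has_derivative_id] by (simp add: id_def)
  finally show ?thesis by (simp add: jacobian_def matrix_id_mat_1)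
qed

lemma det_jacobian_transition_nonzero:
  assumes "\<kappa> \<in> \<A>" "\<kappa>' \<in> \<A>" "p \<in> fst \<kappa> \<inter> fst \<kappa>'"
  shows "det (jacobian (transition \<kappa> \<kappa>') (at (snd \<kappa> p))) \<noteq> 0"
proof -
  have "det (jacobian (transition \<kappa>' \<kappa>) (at (snd \<kappa>' p)) ** jacobian (transition \<kappa> \<kappa>') (at (snd \<kappa> p))) = 1"
    using jacobian_transition_compose[OF assms(1,2,1), of p] jacobian_transition_self[OF assms(1), of p] assms(3)
    by (metis IntD1 IntI det_I)
  then show ?thesis by (auto simp: det_mul)
qed

lemma overlap_image_iff: "\<kappa> \<in> \<A> \<Longrightarrow> p \<in> fst \<kappa> \<Longrightarrow> snd \<kappa> p \<in> overlap \<kappa> \<kappa>' \<longleftrightarrow> p \<in> fst \<kappa>'"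
  unfolding overlap_def using is_chart_inj_on[OF is_chart, of \<kappa>] by (auto dest: inj_onD)

lemma extend_half_density_self:
  assumes "\<kappa> \<in> \<A>" "x \<in> chart_range \<kappa>"
  shows "extend_half_density \<kappa> g \<kappa> x = g x"
proof -
  obtain p where p: "p \<in> fst \<kappa>" "x = snd \<kappa> p" using assms(2) by (auto simp: chart_range_def)
  then show ?thesis
    unfolding extend_half_density_def
    using overlap_image_iff[OF assms(1) p(1)] jacobian_transition_self[OF assms(1) p(1)]
      transition_apply[OF is_chart[OF assms(1)] p(1)] by simp
qed

lemma extend_half_density_image:
  assumes "\<kappa> \<in> \<A>" "\<kappa>' \<in> \<A>" "p \<in> fst \<kappa>'"
  shows "extend_half_density \<kappa> g \<kappa>' (snd \<kappa>' p) = (if p \<in> fst \<kappa>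
    then sqrt \<bar>det (jacobian (transition \<kappa>' \<kappa>) (at (snd \<kappa>' p)))\<bar> *\<^sub>R g (snd \<kappa> p) else 0)"
  unfolding extend_half_density_def overlap_image_iff[OF assms(2,3)]
  using transition_apply[OF is_chart[OF assms(2)] assms(3)] by simp

text \<open>Two open sets cover the range of \<open>\<kappa>'\<close>: the overlap with
  \<open>\<kappa>\<close>, where the weighted formula is smooth, and the complement of the support,
  where the field vanishes. On their intersection both descriptions hold.\<close>

lemma smooth_on_extend_half_density:
  assumes "\<kappa> \<in> \<A>" "\<kappa>' \<in> \<A>" "smooth_on (chart_range \<kappa>) g" "compact K" "K \<subseteq> chart_range \<kappa>"
    "\<And>x. x \<in> chart_range \<kappa> - K \<Longrightarrow> g x = 0"
  shows "smooth_on (chart_range \<kappa>') (extend_half_density \<kappa> g \<kappa>')"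
proof -
  let ?e = "extend_half_density \<kappa> g \<kappa>'"
  let ?U = "topspace M - {p \<in> fst \<kappa>. snd \<kappa> p \<in> K}"
  let ?V = "snd \<kappa>' ` (fst \<kappa>' \<inter> ?U)"
  have openV: "open ?V"
    using is_chart_open_image[OF is_chart[OF assms(2)]]
      is_chart_closedin_vimage[OF is_chart[OF assms(1)] Hausdorff assms(4,5)] by blast
  have "?e y = 0" if "y \<in> ?V" for y
  proof -
    from that obtain p where p: "p \<in> fst \<kappa>'" "p \<notin> fst \<kappa> \<or> snd \<kappa> p \<notin> K" "y = snd \<kappa>' p" by blast
    then have "p \<in> fst \<kappa> \<Longrightarrow> g (snd \<kappa> p) = 0"
      using assms(6)[of "snd \<kappa> p"] by (simp add: chart_range_def)
    then show ?thesis
      unfolding p(3) extend_half_density_image[OF assms(1,2) p(1)] by simp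
  qed
  then have V: "smooth_on ?V ?e"
    using smooth_on_cong[OF openV, of ?e "\<lambda>_. 0"] smooth_on_const[OF openV] by blast
  note O = open_overlap[OF assms(2,1)]
  note tr = smooth_transition[OF assms(2,1)]
  have "smooth_on (overlap \<kappa>' \<kappa>)
    (\<lambda>y. sqrt \<bar>det (jacobian (transition \<kappa>' \<kappa>) (at y))\<bar> *\<^sub>R g (transition \<kappa>' \<kappa> y))"
  proof (intro smooth_on_scaleR[OF O] smooth_on_sqrt_abs[OF O smooth_on_det_jacobian[OF O tr]]
      smooth_on_compose[OF O open_chart_range[OF assms(1)] _ tr assms(3)])
    fix y assume "y \<in> overlap \<kappa>' \<kappa>"
    then show "det (jacobian (transition \<kappa>' \<kappa>) (at y)) \<noteq> 0"
      using det_jacobian_transition_nonzero[OF assms(2,1)] by (auto simp: overlap_def)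
  next
    show "transition \<kappa>' \<kappa> ` overlap \<kappa>' \<kappa> \<subseteq> chart_range \<kappa>"
      using transition_apply[OF is_chart[OF assms(2)], of _ \<kappa>] by (auto simp: overlap_def chart_range_def)
  qed
  then have W: "smooth_on (overlap \<kappa>' \<kappa>) ?e"
    using smooth_on_cong[OF O, of ?e] by (simp add: extend_half_density_def)
  have "chart_range \<kappa>' \<subseteq> ?V \<union> overlap \<kappa>' \<kappa>"
    using openin_subset[OF is_chart_openin[OF is_chart[OF assms(2)]]]
    by (auto simp: chart_range_def overlap_def)
  then show ?thesis
    using smooth_on_subset[OF smooth_on_Un[OF openV O V W]] by blast
qed

lemma extend_half_density_in_half_density_columns:
  assumes "\<kappa> \<in> \<A>" "smooth_on (chart_range \<kappa>) g" "compact K" "K \<subseteq> chart_range \<kappa>"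
    "\<And>x. x \<in> chart_range \<kappa> - K \<Longrightarrow> g x = 0"
  shows "extend_half_density \<kappa> g \<in> half_density_columns \<A>"
  unfolding half_density_columns_def
proof (safe)
  fix \<kappa>' assume "\<kappa>' \<in> \<A>"
  then show "smooth_on (chart_range \<kappa>') (extend_half_density \<kappa> g \<kappa>')"
    using smooth_on_extend_half_density[OF assms(1) _ assms(2-5)] by simp
next
  fix \<kappa>' \<kappa>'' x assume k: "\<kappa>' \<in> \<A>" "\<kappa>'' \<in> \<A>" and "x \<in> overlap \<kappa>' \<kappa>''"
  then obtain p where p: "p \<in> fst \<kappa>'" "p \<in> fst \<kappa>''" and x: "x = snd \<kappa>' p"
    by (auto simp: overlap_def)
  \<comment> \<open>By the cocycle rule the weights multiply if \<open>p\<close> lies in the domain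
    of \<open>\<kappa>\<close>; otherwise both sides vanish.\<close>
  show "extend_half_density \<kappa> g \<kappa>' x = sqrt \<bar>det (jacobian (transition \<kappa>' \<kappa>'') (at x))\<bar> *\<^sub>R
    extend_half_density \<kappa> g \<kappa>'' (transition \<kappa>' \<kappa>'' x)"
    unfolding x transition_apply[OF is_chart[OF k(1)] p(1)]
      extend_half_density_image[OF assms(1) k(1) p(1)] extend_half_density_image[OF assms(1) k(2) p(2)]
    using jacobian_transition_compose[OF k assms(1), of p] p
    by (simp add: det_mul abs_mult real_sqrt_mult mult.commute)
qed

text \<open>Test half-densities with values along a fixed column \<open>a\<close>. The factor
  \<open>f\<close> is chosen as 1 or as a coordinate; two such columns then differ by a coordinate
  factor, which the bump makes meaningful on the whole manifold.\<close>

definition bump_column :: "'a chart \<Rightarrow> real^3 \<Rightarrow> real \<Rightarrow> (real^3 \<Rightarrow> real) \<Rightarrow> complex^2 \<Rightarrow> 'a chart \<Rightarrow> real^3 \<Rightarrow> complex^2"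
  where "bump_column \<kappa> c r f a = extend_half_density \<kappa> (\<lambda>x. f x *\<^sub>R ball_bump c r x *\<^sub>R a)"

lemma bump_column_in_half_density_columns:
  assumes "\<kappa> \<in> \<A>" "r > 0" "cball c r \<subseteq> chart_range \<kappa>" "smooth_on UNIV f"
  shows "bump_column \<kappa> c r f a \<in> half_density_columns \<A>"
  unfolding bump_column_def
proof (rule extend_half_density_in_half_density_columns[OF assms(1) _ compact_cball assms(3)])
  have "smooth_on UNIV (\<lambda>x. f x *\<^sub>R ball_bump c r x *\<^sub>R a)"
    by (intro smooth_on_scaleR assms(4) smooth_on_ball_bump smooth_on_const open_UNIV)
  then show "smooth_on (chart_range \<kappa>) (\<lambda>x. f x *\<^sub>R ball_bump c r x *\<^sub>R a)"
    using smooth_on_subset by blast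
  show "f x *\<^sub>R ball_bump c r x *\<^sub>R a = 0" if "x \<in> chart_range \<kappa> - cball c r" for x
    using that ball_bump_eq_0_iff[OF assms(2), of c x] ball_subset_cball[of c r] by auto
qed

lemma bump_column_outside:
  assumes "\<kappa> \<in> \<A>" "\<kappa>' \<in> \<A>" "p \<in> fst \<kappa>'" "p \<notin> fst \<kappa>"
  shows "bump_column \<kappa> c r f a \<kappa>' (snd \<kappa>' p) = 0"
  using extend_half_density_image[OF assms(1-3)] assms(4) by (simp add: bump_column_def)

lemma bump_column_self:
  assumes "\<kappa> \<in> \<A>" "x \<in> chart_range \<kappa>"
  shows "bump_column \<kappa> c r f a \<kappa> x = f x *\<^sub>R ball_bump c r x *\<^sub>R a"
  unfolding bump_column_def extend_half_density_self[OF assms] ..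

end

section \<open>The principal symbol of a self-adjoint operator\<close>

lemma set_integrable_continuous_compact_support:
  fixes F :: "'b::euclidean_space \<Rightarrow> 'c::{banach, second_countable_topology}"
  assumes "continuous_on R F" "compact K" "K \<subseteq> R" "\<And>x. x \<in> R - K \<Longrightarrow> F x = 0"
  shows "set_integrable lborel R F"
proof -
  have "integrable lborel (\<lambda>x. indicator K x *\<^sub>R F x)"
    using borel_integrable_compact[OF assms(2) continuous_on_subset[OF assms(1,3)]] .
  moreover have "(\<lambda>x. indicator K x *\<^sub>R F x) = (\<lambda>x. indicator R x *\<^sub>R F x)"
  proof
    show "indicator K x *\<^sub>R F x = indicator R x *\<^sub>R F x" for x
      using assms(3) assms(4)[of x] by (cases "x \<in> K"; cases "x \<in> R") auto
  qed
  ultimately show ?thesis unfolding set_integrable_def by simp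
qed

text \<open>The fundamental lemma of the calculus of variations for balls centred at the point in
  question. The bump is squared because in the application each of the two test columns contributes
  one factor.\<close>

lemma ball_bump_fundamental:
  fixes h :: "'b::euclidean_space \<Rightarrow> complex"
  assumes "open R" "x0 \<in> R" "continuous_on R h"
    "\<And>r. r > 0 \<Longrightarrow> cball x0 r \<subseteq> R \<Longrightarrow> (LINT x:R|lborel. (ball_bump x0 r x)\<^sup>2 *\<^sub>R h x) = 0"
  shows "h x0 = 0"
proof (rule ccontr)
  assume nz: "h x0 \<noteq> 0"
  \<comment> \<open>This real functional takes the value |h x0|^2 at \<open>h x0\<close>, so it is
    positive on \<open>h\<close> near \<open>x0\<close>, and the complex statement reduces to one
    about signs.\<close>
  define L where "L = (\<lambda>z. Re (cnj (h x0) * z))"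
  have L: "bounded_linear L"
    unfolding L_def by (intro bounded_linear_compose[OF bounded_linear_Re bounded_linear_mult_right])
  have "L (h x0) > 0"
    using nz by (simp add: L_def complex_neq_0 power2_eq_square)
  have cont: "continuous_on R (\<lambda>x. L (h x))"
    using bounded_linear.continuous_on[OF L assms(3)] .
  have "open (R \<inter> (\<lambda>x. L (h x)) -` {0<..})"
    using continuous_open_preimage[OF cont assms(1) open_greaterThan] .
  moreover have "x0 \<in> R \<inter> (\<lambda>x. L (h x)) -` {0<..}" using assms(2) \<open>L (h x0) > 0\<close> by simp
  ultimately obtain r where r: "r > 0" "cball x0 r \<subseteq> R \<inter> (\<lambda>x. L (h x)) -` {0<..}"
    using open_contains_cball_eq by blast
  define F where "F x = indicator R x *\<^sub>R ((ball_bump x0 r x)\<^sup>2 *\<^sub>R h x)" for x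
  have supp: "ball_bump x0 r x = 0" if "x \<notin> cball x0 r" for x
    using that ball_bump_eq_0_iff[OF r(1), of x0 x] ball_subset_cball by blast
  have "continuous_on R (ball_bump x0 r)"
    using continuous_on_subset[OF smooth_on_imp_continuous_on[OF smooth_on_ball_bump]] by blast
  then have "continuous_on R (\<lambda>x. (ball_bump x0 r x)\<^sup>2 *\<^sub>R h x)"
    by (intro continuous_intros assms(3))
  then have intF: "integrable lborel F"
    using set_integrable_continuous_compact_support[of R "\<lambda>x. (ball_bump x0 r x)\<^sup>2 *\<^sub>R h x" "cball x0 r"] r supp
    unfolding F_def set_integrable_def by auto
  have "integral\<^sup>L lborel F = 0"
    using assms(4)[OF r(1)] r(2) unfolding F_def set_lebesgue_integral_def by auto
  then have "integral\<^sup>L lborel (\<lambda>x. L (F x)) = 0"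
    using integral_bounded_linear[OF L intF] linear_0[OF bounded_linear.linear[OF L]] by simp
  moreover have LF: "L (F x) = indicator R x * (ball_bump x0 r x)\<^sup>2 * L (h x)" for x
    unfolding F_def linear_scale[OF bounded_linear.linear[OF L]] by simp
  have "L (F x) \<ge> 0" for x
  proof (cases "x \<in> cball x0 r")
    case True
    then show ?thesis using r(2) unfolding LF by (auto intro!: mult_nonneg_nonneg)
  qed (simp add: LF supp)
  ultimately have "AE x in lborel. L (F x) = 0"
    using integral_nonneg_eq_0_iff_AE[OF integrable_bounded_linear[OF L intF]] by simp
  moreover have "L (F x) \<noteq> 0" if "x \<in> ball x0 r" for x
  proof -
    have "x \<in> R \<inter> (\<lambda>x. L (h x)) -` {0<..}" using that r(2) ball_subset_cball[of x0 r] by blast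
    then show ?thesis using that ball_bump_eq_0_iff[OF r(1), of x0 x] unfolding LF by simp
  qed
  ultimately have "AE x in lborel. x \<notin> ball x0 r" by (auto elim: eventually_mono)
  then have "emeasure lborel (ball x0 r) = 0"
    using AE_iff_null_sets[of "ball x0 r" lborel] null_setsD1 by auto
  then show False using content_ball_pos[OF r(1), of x0] by (simp add: measure_def)
qed

lemma hermitian_product_axis:
  "hermitian_product u (axis i 1) = cnj (u $ i)" "hermitian_product (axis i 1) u = u $ i"
proof -
  show "hermitian_product u (axis i 1) = cnj (u $ i)"
    by (simp add: hermitian_product_def axis_def if_distrib[of "\<lambda>t. _ * t"] cong: if_cong)
  show "hermitian_product (axis i 1) u = u $ i"
    by (simp add: hermitian_product_def axis_def if_distrib[of cnj] if_distrib[of "\<lambda>t. t * _"] cong: if_cong)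
qed

lemma hermitian_product_algebra:
  "hermitian_product (u + v) w = hermitian_product u w + hermitian_product v w"
  "hermitian_product w (u + v) = hermitian_product w u + hermitian_product w v"
  "hermitian_product (c *s u) w = cnj c * hermitian_product u w"
  "hermitian_product w (c *s u) = c * hermitian_product w u"
  "hermitian_product (t *\<^sub>R u) w = of_real t * hermitian_product u w"
  "hermitian_product w (t *\<^sub>R u) = of_real t * hermitian_product w u"
  unfolding hermitian_product_def sum_2
  by (simp_all add: algebra_simps scaleR_conv_of_real[where 'a=complex])

section \<open>Commutators with coordinates, and consequences of self-adjointness\<close>

locale first_order_system = manifold M \<A>
  for M :: "'a topology" and \<A> :: "'a chart set" +
  fixes A :: "('a chart \<Rightarrow> real^3 \<Rightarrow> complex^2) \<Rightarrow> ('a chart \<Rightarrow> real^3 \<Rightarrow> complex^2)"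
    and \<sigma> :: "'a chart \<Rightarrow> real^3 \<Rightarrow> 3 \<Rightarrow> complex^2^2"
    and B :: "'a chart \<Rightarrow> real^3 \<Rightarrow> complex^2^2"
  assumes first_order: "first_order_operator \<A> A \<sigma> B"
begin

lemma smooth_symbol: "\<kappa> \<in> \<A> \<Longrightarrow> smooth_on (chart_range \<kappa>) (\<lambda>x. \<sigma> \<kappa> x \<alpha>)"
  using first_order by (simp add: first_order_operator_def)

lemma operator_in_half_density_columns:
  "u \<in> half_density_columns \<A> \<Longrightarrow> A u \<in> half_density_columns \<A>"
  using first_order by (simp add: first_order_operator_def)

lemma operator_apply:
  "u \<in> half_density_columns \<A> \<Longrightarrow> \<kappa> \<in> \<A> \<Longrightarrow> x \<in> chart_range \<kappa> \<Longrightarrow> A u \<kappa> x =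
     (- \<i>) *s (\<Sum>\<alpha>\<in>UNIV. \<sigma> \<kappa> x \<alpha> *v frechet_derivative (u \<kappa>) (at x) (axis \<alpha> 1)) + B \<kappa> x *v u \<kappa> x"
  using first_order by (simp add: first_order_operator_def)

lemma smooth_half_density: "u \<in> half_density_columns \<A> \<Longrightarrow> \<kappa> \<in> \<A> \<Longrightarrow> smooth_on (chart_range \<kappa>) (u \<kappa>)"
  by (simp add: half_density_columns_def)

lemma half_density_transform:
  assumes "u \<in> half_density_columns \<A>" "\<kappa> \<in> \<A>" "\<kappa>' \<in> \<A>" "p \<in> fst \<kappa>" "p \<in> fst \<kappa>'"
  shows "u \<kappa> (snd \<kappa> p) = sqrt \<bar>det (jacobian (transition \<kappa> \<kappa>') (at (snd \<kappa> p)))\<bar> *\<^sub>R u \<kappa>' (snd \<kappa>' p)"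
proof -
  have "snd \<kappa> p \<in> overlap \<kappa> \<kappa>'" using assms(4,5) by (auto simp: overlap_def)
  then show ?thesis
    using assms(1-3) transition_apply[OF is_chart[OF assms(2)] assms(4), of \<kappa>']
    unfolding half_density_columns_def by fastforce
qed

text \<open>The commutator of \<open>A\<close> with \<open>f\<close> is multiplication by the symbol
  at the differential of \<open>f\<close>, up to the factor -i: by the Leibniz rule all derivatives
  of \<open>u\<close> and the zero order term recombine to \<open>f A u\<close>. The relation
  between \<open>u\<close> and \<open>w\<close> is demanded only on an open set, so \<open>f\<close>
  may be local.\<close>

lemma operator_commutator:
  assumes "u \<in> half_density_columns \<A>" "w \<in> half_density_columns \<A>" "\<kappa> \<in> \<A>"
    "open S" "x \<in> S" "S \<subseteq> chart_range \<kappa>" "f differentiable (at x)"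
    "\<And>y. y \<in> S \<Longrightarrow> w \<kappa> y = f y *\<^sub>R u \<kappa> y"
  shows "A w \<kappa> x = f x *\<^sub>R A u \<kappa> x
    + (- \<i>) *s (\<Sum>\<alpha>\<in>UNIV. frechet_derivative f (at x) (axis \<alpha> 1) *\<^sub>R (\<sigma> \<kappa> x \<alpha> *v u \<kappa> x))"
proof -
  have x: "x \<in> chart_range \<kappa>" using assms by blast
  have f: "(f has_derivative frechet_derivative f (at x)) (at x)"
    using assms(7) frechet_derivative_works by blast
  have u: "(u \<kappa> has_derivative frechet_derivative (u \<kappa>) (at x)) (at x)"
    using smooth_onD_has_derivative[OF smooth_half_density[OF assms(1,3)] x] .
  have "frechet_derivative (w \<kappa>) (at x) = frechet_derivative (\<lambda>y. f y *\<^sub>R u \<kappa> y) (at x)"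
    using frechet_derivative_transform[OF assms(4,5,8)] .
  also have "\<dots> = (\<lambda>v. f x *\<^sub>R frechet_derivative (u \<kappa>) (at x) v + frechet_derivative f (at x) v *\<^sub>R u \<kappa> x)"
    using frechet_derivative_at[OF has_derivative_scaleR[OF f u]] by simp
  finally have D: "frechet_derivative (w \<kappa>) (at x) v =
    f x *\<^sub>R frechet_derivative (u \<kappa>) (at x) v + frechet_derivative f (at x) v *\<^sub>R u \<kappa> x" for v by simp
  show ?thesis
    unfolding operator_apply[OF assms(1,3) x] operator_apply[OF assms(2,3) x] D assms(8)[OF assms(5)]
    by (simp add: vec_eq_iff matrix_vector_mult_def sum_2 sum_3 forall_2 scaleR_conv_of_real[where 'a=complex] algebra_simps)
qed

lemma operator_commutator_bump:
  assumes "\<kappa> \<in> \<A>" "r > 0" "cball c r \<subseteq> chart_range \<kappa>" "x \<in> chart_range \<kappa>"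
  shows "A (bump_column \<kappa> c r (\<lambda>x. x $ \<beta>) a) \<kappa> x = (x $ \<beta>) *\<^sub>R A (bump_column \<kappa> c r (\<lambda>_. 1) a) \<kappa> x
    + (- \<i>) *s (ball_bump c r x *\<^sub>R (\<sigma> \<kappa> x \<beta> *v a))"
proof -
  let ?u = "bump_column \<kappa> c r (\<lambda>_. 1) a" and ?w = "bump_column \<kappa> c r (\<lambda>x. x $ \<beta>) a"
  have "A ?w \<kappa> x = (x $ \<beta>) *\<^sub>R A ?u \<kappa> x + (- \<i>) *s (\<Sum>\<alpha>\<in>UNIV.
      frechet_derivative (\<lambda>x. x $ \<beta>) (at x) (axis \<alpha> 1) *\<^sub>R (\<sigma> \<kappa> x \<alpha> *v ?u \<kappa> x))"
  proof (rule operator_commutator[where S="chart_range \<kappa>"])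
    show "(\<lambda>x::real^3. x $ \<beta>) differentiable (at x)"
      using smooth_onD_has_derivative[OF smooth_on_coordinate] unfolding differentiable_def by blast
    show "?w \<kappa> y = (y $ \<beta>) *\<^sub>R ?u \<kappa> y" if "y \<in> chart_range \<kappa>" for y
      unfolding bump_column_def extend_half_density_self[OF assms(1) that] by simp
  qed (use assms in \<open>auto intro!: bump_column_in_half_density_columns open_chart_range
      smooth_on_coordinate smooth_on_const\<close>)
  also have "(\<Sum>\<alpha>\<in>UNIV. frechet_derivative (\<lambda>x. x $ \<beta>) (at x) (axis \<alpha> 1) *\<^sub>R (\<sigma> \<kappa> x \<alpha> *v ?u \<kappa> x))
      = \<sigma> \<kappa> x \<beta> *v ?u \<kappa> x"
    by (simp add: frechet_derivative_coordinate if_distrib[of "\<lambda>t. t *\<^sub>R _"] cong: if_cong)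
  also have "?u \<kappa> x = ball_bump c r x *\<^sub>R a"
    unfolding bump_column_def extend_half_density_self[OF assms(1,4)] by simp
  also have "\<sigma> \<kappa> x \<beta> *v (ball_bump c r x *\<^sub>R a) = ball_bump c r x *\<^sub>R (\<sigma> \<kappa> x \<beta> *v a)"
    by (simp add: vec_eq_iff matrix_vector_mult_def sum_2 forall_2 scaleR_conv_of_real[where 'a=complex] algebra_simps)
  finally show ?thesis .
qed

text \<open>Extracted from the covariance of \<open>A\<close> on half-densities. In
  \<open>\<kappa>\<close> the columns \<open>?w\<close> and \<open>?u\<close> differ by the
  coordinate \<open>x\<^sup>\<beta>\<close>, in \<open>\<kappa>'\<close> by a component of the
  coordinate change. Comparing \<open>A ?w\<close> in both charts, the terms with
  \<open>A ?u\<close> cancel and the two commutators remain, with a common factor that is nonzero at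
  the centre of the bump.\<close>

lemma symbol_transform:
  assumes "\<kappa> \<in> \<A>" "\<kappa>' \<in> \<A>" "p \<in> fst \<kappa>" "p \<in> fst \<kappa>'"
  shows "\<sigma> \<kappa> (snd \<kappa> p) \<beta> =
    (\<Sum>\<alpha>\<in>UNIV. jacobian (transition \<kappa>' \<kappa>) (at (snd \<kappa>' p)) $ \<beta> $ \<alpha> *\<^sub>R \<sigma> \<kappa>' (snd \<kappa>' p) \<alpha>)"
    (is "_ = ?S")
proof -
  let ?x = "snd \<kappa> p" and ?y = "snd \<kappa>' p" and ?t = "transition \<kappa>' \<kappa>"
  let ?s = "sqrt \<bar>det (jacobian ?t (at ?y))\<bar>"
  have x: "?x \<in> chart_range \<kappa>" and y: "?y \<in> chart_range \<kappa>'" using assms by (auto simp: chart_range_def)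
  have yO: "?y \<in> overlap \<kappa>' \<kappa>" using overlap_image_iff[OF assms(2,4)] assms(3) by simp
  obtain r where r: "r > 0" "cball ?x r \<subseteq> chart_range \<kappa>"
    using open_contains_cball_eq[OF open_chart_range[OF assms(1)]] x by blast
  have bump: "ball_bump ?x r ?x \<noteq> 0" using ball_bump_eq_0_iff[OF r(1), of ?x ?x] r(1) by simp
  have s: "?s \<noteq> 0" using det_jacobian_transition_nonzero[OF assms(2,1), of p] assms by simp
  have "\<sigma> \<kappa> ?x \<beta> *v a = ?S *v a" for a
  proof -
    let ?u = "bump_column \<kappa> ?x r (\<lambda>_. 1) a" and ?w = "bump_column \<kappa> ?x r (\<lambda>x. x $ \<beta>) a"
    have u: "?u \<in> half_density_columns \<A>" and w: "?w \<in> half_density_columns \<A>"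
      using r assms by (auto intro!: bump_column_in_half_density_columns smooth_on_coordinate smooth_on_const)
    have t: "(?t has_derivative frechet_derivative ?t (at ?y)) (at ?y)"
      using smooth_onD_has_derivative[OF smooth_transition[OF assms(2,1)] yO] .
    have D: "((\<lambda>z. ?t z $ \<beta>) has_derivative (\<lambda>v. frechet_derivative ?t (at ?y) v $ \<beta>)) (at ?y)"
      by (rule bounded_linear.has_derivative[OF bounded_linear_vec_nth t])
    have ty: "?t ?y = ?x" using transition_apply[OF is_chart[OF assms(2)] assms(4)] .
    have "A ?w \<kappa>' ?y = (?t ?y $ \<beta>) *\<^sub>R A ?u \<kappa>' ?y + (- \<i>) *s (\<Sum>\<alpha>\<in>UNIV.
      frechet_derivative (\<lambda>z. ?t z $ \<beta>) (at ?y) (axis \<alpha> 1) *\<^sub>R (\<sigma> \<kappa>' ?y \<alpha> *v ?u \<kappa>' ?y))"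
    proof (rule operator_commutator[OF u w assms(2) open_overlap[OF assms(2,1)] yO])
      show "?w \<kappa>' z = (?t z $ \<beta>) *\<^sub>R ?u \<kappa>' z" if "z \<in> overlap \<kappa>' \<kappa>" for z
        using that by (simp add: bump_column_def extend_half_density_def)
      show "overlap \<kappa>' \<kappa> \<subseteq> chart_range \<kappa>'" by (auto simp: overlap_def chart_range_def)
      show "(\<lambda>z. ?t z $ \<beta>) differentiable (at ?y)" using D by (auto simp: differentiable_def)
    qed
    moreover have "A ?w \<kappa>' ?y = ?s *\<^sub>R ((?x $ \<beta>) *\<^sub>R A ?u \<kappa> ?x + (- \<i>) *s (ball_bump ?x r ?x *\<^sub>R (\<sigma> \<kappa> ?x \<beta> *v a)))"
      unfolding half_density_transform[OF operator_in_half_density_columns[OF w] assms(2,1,4,3)]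
        operator_commutator_bump[OF assms(1) r x] ..
    moreover have "A ?u \<kappa>' ?y = ?s *\<^sub>R A ?u \<kappa> ?x"
      using half_density_transform[OF operator_in_half_density_columns[OF u] assms(2,1,4,3)] .
    moreover have "?u \<kappa>' ?y = ?s *\<^sub>R ball_bump ?x r ?x *\<^sub>R a"
      using extend_half_density_image[OF assms(1,2,4)] assms(3) by (simp add: bump_column_def)
    moreover have "frechet_derivative (\<lambda>z. ?t z $ \<beta>) (at ?y) (axis \<alpha> 1) = jacobian ?t (at ?y) $ \<beta> $ \<alpha>" for \<alpha>
      unfolding jacobian_nth using frechet_derivative_at[OF D] by metis
    ultimately have "(- \<i>) *s ((?s * ball_bump ?x r ?x) *\<^sub>R (\<sigma> \<kappa> ?x \<beta> *v a)) =
        (- \<i>) *s ((?s * ball_bump ?x r ?x) *\<^sub>R (?S *v a))"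
      unfolding ty
      by (simp add: vec_eq_iff matrix_vector_mult_def sum_2 sum_3 forall_2 scaleR_conv_of_real[where 'a=complex] algebra_simps)
    then show ?thesis using s bump by (simp add: vector_mul_lcancel)
  qed
  then show ?thesis using matrix_eq by blast
qed

text \<open>With \<open>\<kappa>\<close> at the head of the list, its whole range is integrated, and
  every later piece lies outside its domain, where the density vanishes.\<close>

lemma density_integral_supported:
  assumes "\<kappa> \<in> \<A>" "finite_chart_cover M \<A> (\<kappa> # \<kappa>s)"
    "\<And>\<kappa>' p. \<kappa>' \<in> \<A> \<Longrightarrow> p \<in> fst \<kappa>' \<Longrightarrow> p \<notin> fst \<kappa> \<Longrightarrow> \<rho> \<kappa>' (snd \<kappa>' p) = 0"
  shows "density_integral (\<kappa> # \<kappa>s) \<rho> = (LINT x:chart_range \<kappa>|lborel. \<rho> \<kappa> x)"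
proof -
  let ?D = "\<lambda>i. snd ((\<kappa> # \<kappa>s) ! i) ` (fst ((\<kappa> # \<kappa>s) ! i) - (\<Union>j<i. fst ((\<kappa> # \<kappa>s) ! j)))"
  have "(LINT x : ?D (Suc i) | lborel. \<rho> ((\<kappa> # \<kappa>s) ! Suc i) x) = 0" if i: "i < length \<kappa>s" for i
  proof -
    have in_A: "\<kappa>s ! i \<in> \<A>" using assms(2) i by (auto simp: finite_chart_cover_def)
    have "\<rho> (\<kappa>s ! i) x = 0" if "x \<in> ?D (Suc i)" for x
    proof -
      from that obtain p where p: "p \<in> fst (\<kappa>s ! i)" "x = snd (\<kappa>s ! i) p"
        "p \<notin> (\<Union>j<Suc i. fst ((\<kappa> # \<kappa>s) ! j))" by auto
      from p(3) have "p \<notin> fst ((\<kappa> # \<kappa>s) ! 0)" by blast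
      then show ?thesis using assms(3)[OF in_A p(1)] p(2) by simp
    qed
    then have "(\<lambda>x. indicator (?D (Suc i)) x *\<^sub>R \<rho> ((\<kappa> # \<kappa>s) ! Suc i) x) = (\<lambda>x. 0)"
      by (auto simp: fun_eq_iff indicator_def)
    then show ?thesis unfolding set_lebesgue_integral_def by simp
  qed
  then show ?thesis
    unfolding density_integral_def
    by (simp add: sum.lessThan_Suc_shift chart_range_def del: sum.lessThan_Suc)
qed

lemma ex_finite_chart_cover:
  assumes "\<kappa> \<in> \<A>" "compact_space M"
  shows "\<exists>\<kappa>s. finite_chart_cover M \<A> (\<kappa> # \<kappa>s)"
proof -
  have "\<exists>\<F>. finite \<F> \<and> \<F> \<subseteq> fst ` \<A> \<and> topspace M \<subseteq> \<Union>\<F>"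
    using assms(2) is_chart_openin[OF is_chart] charts_cover
    unfolding compact_space_def compactin_def by (metis imageE order_refl)
  then obtain C where C: "finite C" "C \<subseteq> \<A>" "topspace M \<subseteq> \<Union>(fst ` C)"
    using finite_subset_image by metis
  obtain \<kappa>s where "set \<kappa>s = C" using finite_list[OF C(1)] by blast
  moreover have "fst \<kappa> \<subseteq> topspace M" "(\<Union>\<kappa>\<in>C. fst \<kappa>) \<subseteq> topspace M"
    using charts_cover assms(1) C(2) by blast+
  ultimately have "finite_chart_cover M \<A> (\<kappa> # \<kappa>s)"
    unfolding finite_chart_cover_def using C assms(1) by (auto simp del: split_paired_All split_paired_Ex)
  then show ?thesis ..
qed

lemma self_adjoint_supported:
  assumes "\<kappa> \<in> \<A>" "compact_space M" "self_adjoint_operator M \<A> A"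
    "u \<in> half_density_columns \<A>" "w \<in> half_density_columns \<A>"
    "\<And>\<kappa>' p. \<kappa>' \<in> \<A> \<Longrightarrow> p \<in> fst \<kappa>' \<Longrightarrow> p \<notin> fst \<kappa> \<Longrightarrow> u \<kappa>' (snd \<kappa>' p) = 0"
    "\<And>\<kappa>' p. \<kappa>' \<in> \<A> \<Longrightarrow> p \<in> fst \<kappa>' \<Longrightarrow> p \<notin> fst \<kappa> \<Longrightarrow> w \<kappa>' (snd \<kappa>' p) = 0"
  shows "(LINT x:chart_range \<kappa>|lborel. hermitian_product (A u \<kappa> x) (w \<kappa> x)) =
    (LINT x:chart_range \<kappa>|lborel. hermitian_product (u \<kappa> x) (A w \<kappa> x))"
proof -
  obtain \<kappa>s where cover: "finite_chart_cover M \<A> (\<kappa> # \<kappa>s)"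
    using ex_finite_chart_cover[OF assms(1,2)] by blast
  have "density_integral (\<kappa> # \<kappa>s) (\<lambda>\<kappa> x. hermitian_product (A u \<kappa> x) (w \<kappa> x)) =
      (LINT x:chart_range \<kappa>|lborel. hermitian_product (A u \<kappa> x) (w \<kappa> x))"
    by (rule density_integral_supported[OF assms(1) cover]) (simp add: assms(7) hermitian_product_def)
  moreover have "density_integral (\<kappa> # \<kappa>s) (\<lambda>\<kappa> x. hermitian_product (u \<kappa> x) (A w \<kappa> x)) =
      (LINT x:chart_range \<kappa>|lborel. hermitian_product (u \<kappa> x) (A w \<kappa> x))"
    by (rule density_integral_supported[OF assms(1) cover]) (simp add: assms(6) hermitian_product_def)
  moreover have "density_integral (\<kappa> # \<kappa>s) (\<lambda>\<kappa> x. hermitian_product (A u \<kappa> x) (w \<kappa> x)) =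
    density_integral (\<kappa> # \<kappa>s) (\<lambda>\<kappa> x. hermitian_product (u \<kappa> x) (A w \<kappa> x))"
    using assms(3)[unfolded self_adjoint_operator_def, rule_format, OF conjI[OF cover conjI[OF assms(4,5)]]] .
  ultimately show ?thesis by (simp only:)
qed

text \<open>Needed to combine two self-adjointness identities under one integral sign; the bump
  factor supplies compact support.\<close>

lemma bump_column_integrable:
  assumes "\<kappa> \<in> \<A>" "r > 0" "cball c r \<subseteq> chart_range \<kappa>"
    "s \<in> half_density_columns \<A>" "bump_column \<kappa> c r f a \<in> half_density_columns \<A>"
  shows "set_integrable lborel (chart_range \<kappa>) (\<lambda>x. hermitian_product (A s \<kappa> x) (bump_column \<kappa> c r f a \<kappa> x))"
    and "set_integrable lborel (chart_range \<kappa>) (\<lambda>x. hermitian_product (bump_column \<kappa> c r f a \<kappa> x) (A s \<kappa> x))"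
proof -
  let ?t = "bump_column \<kappa> c r f a"
  have cont: "continuous_on (chart_range \<kappa>) (A s \<kappa>)" "continuous_on (chart_range \<kappa>) (?t \<kappa>)"
    using smooth_on_imp_continuous_on[OF smooth_half_density[OF _ assms(1)]]
      operator_in_half_density_columns[OF assms(4)] assms(5) by blast+
  have zero: "?t \<kappa> x = 0" if "x \<in> chart_range \<kappa> - cball c r" for x
    using that bump_column_self[OF assms(1), of x] ball_bump_eq_0_iff[OF assms(2), of c x]
      ball_subset_cball[of c r] by auto
  show "set_integrable lborel (chart_range \<kappa>) (\<lambda>x. hermitian_product (A s \<kappa> x) (?t \<kappa> x))"
  proof (rule set_integrable_continuous_compact_support[OF _ compact_cball assms(3)])
    show "continuous_on (chart_range \<kappa>) (\<lambda>x. hermitian_product (A s \<kappa> x) (?t \<kappa> x))"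
      unfolding hermitian_product_def by (intro continuous_intros cont)
  qed (simp add: zero hermitian_product_def)
  show "set_integrable lborel (chart_range \<kappa>) (\<lambda>x. hermitian_product (?t \<kappa> x) (A s \<kappa> x))"
  proof (rule set_integrable_continuous_compact_support[OF _ compact_cball assms(3)])
    show "continuous_on (chart_range \<kappa>) (\<lambda>x. hermitian_product (?t \<kappa> x) (A s \<kappa> x))"
      unfolding hermitian_product_def by (intro continuous_intros cont)
  qed (simp add: zero hermitian_product_def)
qed

text \<open>Self-adjointness is applied twice, with the coordinate factor first on the left column
  and then on the right one. In the difference all terms containing \<open>A ?u\<close> cancel
  pointwise, and what is left is the squared bump times the defect \<open>h\<close> of the Hermitian
  property.\<close>

lemma symbol_hermitian:
  assumes "\<kappa> \<in> \<A>" "compact_space M" "self_adjoint_operator M \<A> A" "x0 \<in> chart_range \<kappa>"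
  shows "cnj (\<sigma> \<kappa> x0 \<beta> $ l $ k) = \<sigma> \<kappa> x0 \<beta> $ k $ l"
proof -
  let ?R = "chart_range \<kappa>"
  let ?a = "axis k 1 :: complex^2" and ?b = "axis l 1 :: complex^2"
  define h where "h x = cnj (\<sigma> \<kappa> x \<beta> $ l $ k) - \<sigma> \<kappa> x \<beta> $ k $ l" for x
  have "continuous_on ?R (\<lambda>x. \<sigma> \<kappa> x \<beta>)"
    using smooth_on_imp_continuous_on[OF smooth_symbol[OF assms(1)]] .
  then have cont: "continuous_on ?R h" unfolding h_def by (intro continuous_intros)
  have "(LINT x:?R|lborel. (ball_bump x0 r x)\<^sup>2 *\<^sub>R h x) = 0" if r: "r > 0" "cball x0 r \<subseteq> ?R" for r
  proof -
    let ?u = "bump_column \<kappa> x0 r (\<lambda>_. 1)" and ?w = "bump_column \<kappa> x0 r (\<lambda>x. x $ \<beta>)"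
    have u: "?u c \<in> half_density_columns \<A>" and w: "?w c \<in> half_density_columns \<A>" for c
      using r assms(1) by (auto intro!: bump_column_in_half_density_columns smooth_on_coordinate smooth_on_const)
    let ?F1 = "\<lambda>x. hermitian_product (A (?w ?a) \<kappa> x) (?u ?b \<kappa> x)"
    let ?F2 = "\<lambda>x. hermitian_product (?w ?a \<kappa> x) (A (?u ?b) \<kappa> x)"
    let ?F3 = "\<lambda>x. hermitian_product (A (?u ?a) \<kappa> x) (?w ?b \<kappa> x)"
    let ?F4 = "\<lambda>x. hermitian_product (?u ?a \<kappa> x) (A (?w ?b) \<kappa> x)"
    have I: "set_integrable lborel ?R ?F1" "set_integrable lborel ?R ?F2"
      "set_integrable lborel ?R ?F3" "set_integrable lborel ?R ?F4"
      by (rule bump_column_integrable[OF assms(1) r]; rule u w)+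
    have "(LINT x:?R|lborel. ?F1 x) = (LINT x:?R|lborel. ?F2 x)"
      "(LINT x:?R|lborel. ?F3 x) = (LINT x:?R|lborel. ?F4 x)"
      by (rule self_adjoint_supported[OF assms(1-3)];
          (rule u w | rule bump_column_outside[OF assms(1)]; assumption))+
    then have "(LINT x:?R|lborel. (?F1 x - ?F2 x) - (?F3 x - ?F4 x)) = 0"
      using I by simp
    \<comment> \<open>The integral identities pair \<open>?F1\<close> with \<open>?F2\<close> and
      \<open>?F3\<close> with \<open>?F4\<close>, but the pointwise cancellation is between
      \<open>?F1\<close> and \<open>?F3\<close> and between \<open>?F2\<close> and
      \<open>?F4\<close>.\<close>
    moreover have "(?F1 x - ?F2 x) - (?F3 x - ?F4 x) = \<i> * ((ball_bump x0 r x)\<^sup>2 *\<^sub>R h x)" if x: "x \<in> ?R" for x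
    proof -
      have "(\<sigma> \<kappa> x \<beta> *v axis i 1) $ j = \<sigma> \<kappa> x \<beta> $ j $ i" for i j
        by (simp add: matrix_vector_mult_def axis_def if_distrib[of "\<lambda>t. _ * t"] cong: if_cong)
      then have "?F1 x - ?F3 x = \<i> * (ball_bump x0 r x)\<^sup>2 * cnj (\<sigma> \<kappa> x \<beta> $ l $ k)"
        "?F2 x - ?F4 x = \<i> * (ball_bump x0 r x)\<^sup>2 * \<sigma> \<kappa> x \<beta> $ k $ l"
        unfolding operator_commutator_bump[OF assms(1) r x] bump_column_self[OF assms(1) x]
          hermitian_product_algebra hermitian_product_axis
        by (simp_all add: algebra_simps power2_eq_square scaleR_conv_of_real[where 'a=complex])
      then have "(?F1 x - ?F3 x) - (?F2 x - ?F4 x) = \<i> * ((ball_bump x0 r x)\<^sup>2 *\<^sub>R h x)"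
        by (simp add: h_def scaleR_conv_of_real[where 'a=complex] algebra_simps)
      then show ?thesis by (simp add: algebra_simps)
    qed
    then have "(LINT x:?R|lborel. (?F1 x - ?F2 x) - (?F3 x - ?F4 x)) =
        (LINT x:?R|lborel. \<i> * ((ball_bump x0 r x)\<^sup>2 *\<^sub>R h x))"
      using open_chart_range[OF assms(1)] by (intro set_lebesgue_integral_cong) auto
    ultimately have "(LINT x:?R|lborel. \<i> * ((ball_bump x0 r x)\<^sup>2 *\<^sub>R h x)) = 0"
      by (simp only:)
    then show ?thesis by (simp only: set_integral_mult_right mult_eq_0_iff complex_i_not_zero simp_thms)
  qed
  then have "h x0 = 0"
    using ball_bump_fundamental[OF open_chart_range[OF assms(1)] assms(4) cont] by blast
  then show ?thesis by (simp add: h_def)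
qed

end

section \<open>Bloch vectors and triple products\<close>

definition triple_product :: "(3 \<Rightarrow> real) \<Rightarrow> (3 \<Rightarrow> real) \<Rightarrow> (3 \<Rightarrow> real) \<Rightarrow> real" where
  "triple_product u v w = u 1 * (v 2 * w 3 - v 3 * w 2) + u 2 * (v 3 * w 1 - v 1 * w 3)
    + u 3 * (v 1 * w 2 - v 2 * w 1)"

text \<open>The vector \<open>n\<close> with \<open>v v\<^sup>* = (1 + n\<^sub>j \<sigma>\<^sub>j) / 2\<close> for a unit vector \<open>v\<close> and the Pauli matrices \<open>\<sigma>\<^sub>j\<close>.\<close>

definition bloch :: "complex^2 \<Rightarrow> 3 \<Rightarrow> real" where
  "bloch v j = (if j = 1 then 2 * (Re (v $ 1) * Re (v $ 2) + Im (v $ 1) * Im (v $ 2))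
    else if j = 2 then 2 * (Re (v $ 1) * Im (v $ 2) - Im (v $ 1) * Re (v $ 2))
    else (Re (v $ 1))\<^sup>2 + (Im (v $ 1))\<^sup>2 - (Re (v $ 2))\<^sup>2 - (Im (v $ 2))\<^sup>2)"

text \<open>The differential of \<open>bloch\<close> at \<open>v\<close> in direction
  \<open>a\<close>, spelled out so that the identities for it become polynomial.\<close>

definition bloch_deriv :: "complex^2 \<Rightarrow> complex^2 \<Rightarrow> 3 \<Rightarrow> real" where
  "bloch_deriv v a j =
    (if j = 1 then 2 * (Re (a $ 1) * Re (v $ 2) + Re (v $ 1) * Re (a $ 2) + Im (a $ 1) * Im (v $ 2) + Im (v $ 1) * Im (a $ 2))
    else if j = 2 then 2 * (Re (a $ 1) * Im (v $ 2) + Re (v $ 1) * Im (a $ 2) - Im (a $ 1) * Re (v $ 2) - Im (v $ 1) * Re (a $ 2))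
    else 2 * (Re (v $ 1) * Re (a $ 1) + Im (v $ 1) * Im (a $ 1) - Re (v $ 2) * Re (a $ 2) - Im (v $ 2) * Im (a $ 2)))"

lemma norm_complex_pair:
  fixes v :: "complex^2"
  shows "(norm v)\<^sup>2 = (Re (v $ 1))\<^sup>2 + (Im (v $ 1))\<^sup>2 + (Re (v $ 2))\<^sup>2 + (Im (v $ 2))\<^sup>2"
  unfolding power2_norm_eq_inner
  by (simp add: inner_vec_def sum_2 inner_complex_def power2_eq_square)

lemma bloch_has_derivative:
  assumes "(v has_derivative D) (at p)"
  shows "((\<lambda>q. bloch (v q) j) has_derivative (\<lambda>e. bloch_deriv (v p) (D e) j)) (at p)"
proof -
  have N: "((\<lambda>q. v q $ i) has_derivative (\<lambda>e. D e $ i)) (at p)" for i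
    by (rule bounded_linear.has_derivative[OF bounded_linear_vec_nth assms])
  show ?thesis
    unfolding bloch_def bloch_deriv_def
    by (cases "j = 1"; cases "j = 2")
      (auto intro!: derivative_eq_intros N simp: fun_eq_iff algebra_simps power2_eq_square)
qed

text \<open>The left-hand side is 2 Im (\<open>a\<^sup>* b\<close>), and the triple product equals 4
  Im (\<open>a\<^sup>* b\<close>) modulo three real relations: the unit length of \<open>v\<close>
  and the real orthogonality of \<open>a\<close> and \<open>b\<close> to \<open>v\<close>.
  Components along \<open>i v\<close> are allowed; they drop out of both sides.\<close>

lemma row_times_column_bloch:
  assumes "norm v = 1" "v \<bullet> a = 0" "v \<bullet> b = 0"
  shows "- \<i> * (row_times_column (\<chi> j. cnj (a $ j)) b - row_times_column (\<chi> j. cnj (b $ j)) a) =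
    of_real (1 / 2 * triple_product (bloch v) (bloch_deriv v a) (bloch_deriv v b))"
proof -
  have index_neq: "((1::3) = 1) = True" "((2::3) = 1) = False" "((3::3) = 1) = False"
    "((2::3) = 2) = True" "((3::3) = 2) = False" by simp_all
  have "(Re (v $ 1))\<^sup>2 + (Im (v $ 1))\<^sup>2 + (Re (v $ 2))\<^sup>2 + (Im (v $ 2))\<^sup>2 = 1"
    using assms(1) norm_complex_pair[of v] by simp
  moreover have "Re (v $ 1) * Re (a $ 1) + Im (v $ 1) * Im (a $ 1) + Re (v $ 2) * Re (a $ 2) + Im (v $ 2) * Im (a $ 2) = 0"
    "Re (v $ 1) * Re (b $ 1) + Im (v $ 1) * Im (b $ 1) + Re (v $ 2) * Re (b $ 2) + Im (v $ 2) * Im (b $ 2) = 0"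
    using assms(2,3) by (simp_all add: inner_vec_def sum_2 inner_complex_def)
  ultimately have "triple_product (bloch v) (bloch_deriv v a) (bloch_deriv v b) =
      4 * (Re (a $ 1) * Im (b $ 1) - Im (a $ 1) * Re (b $ 1) + Re (a $ 2) * Im (b $ 2) - Im (a $ 2) * Re (b $ 2))"
    unfolding triple_product_def bloch_def bloch_deriv_def index_neq simp_thms if_True if_False by algebra
  then show ?thesis
    by (simp add: row_times_column_def sum_2 complex_eq_iff algebra_simps)
qed

section \<open>Linear algebra of the torsion side\<close>

lemma levi_civita_det:
  "(\<Sum>a\<in>UNIV. \<Sum>b\<in>UNIV. \<Sum>c\<in>UNIV. levi_civita a b c * X $ a $ \<mu> * X $ b $ \<nu> * X $ c $ \<beta>)
   = det X * levi_civita \<mu> \<nu> \<beta>"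
proof -
  have "\<forall>\<mu> \<nu> \<beta>. (\<Sum>a\<in>UNIV. \<Sum>b\<in>UNIV. \<Sum>c\<in>UNIV. levi_civita a b c * X $ a $ \<mu> * X $ b $ \<nu> * X $ c $ \<beta>)
   = det X * levi_civita \<mu> \<nu> \<beta>"
    unfolding forall_3 by (simp add: sum_3 levi_civita_def det_3 algebra_simps)
  then show ?thesis by blast
qed

lemma levi_civita_triple_product:
  "(\<Sum>a\<in>UNIV. \<Sum>b\<in>UNIV. \<Sum>c\<in>UNIV. levi_civita a b c * w a * v b * u c) = - triple_product u v w"
  by (simp add: sum_3 levi_civita_def triple_product_def algebra_simps)

text \<open>Polarisation: the values at the basis vectors and at their pairwise sums determine all
  six independent entries.\<close>

lemma symmetric_quadratic_form_eq_0:
  fixes D :: "real^3^3"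
  assumes "transpose D = D" "\<And>\<xi>::real^3. (\<Sum>\<alpha>\<in>UNIV. \<Sum>\<beta>\<in>UNIV. D $ \<alpha> $ \<beta> * \<xi> $ \<alpha> * \<xi> $ \<beta>) = 0"
  shows "D = 0"
proof -
  have sym: "D $ \<alpha> $ \<beta> = D $ \<beta> $ \<alpha>" for \<alpha> \<beta>
    using arg_cong[OF assms(1), of "\<lambda>A. A $ \<beta> $ \<alpha>"] by (simp add: transpose_def)
  note q = assms(2)[of "vector [1,0,0]"] assms(2)[of "vector [0,1,0]"] assms(2)[of "vector [0,0,1]"]
    assms(2)[of "vector [1,1,0]"] assms(2)[of "vector [0,1,1]"] assms(2)[of "vector [1,0,1]"]
  show ?thesis
    using q sym[of 1 2] sym[of 1 3] sym[of 2 3]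
    by (simp add: vec_eq_iff forall_3 sum_3 vector_3)
qed

text \<open>Here \<open>W\<close> is the coframe of \<open>V\<close> and \<open>X\<close> the
  connection contracted with \<xi>. The factor \<open>det V\<close> trades the permutation symbol in
  coordinate indices for one in frame indices with three factors \<open>V\<close>. The factor with
  index \<nu> cancels against \<open>W\<close>, the one with \<beta> turns \<xi> into
  \<open>V *v \<xi>\<close>, and the one with \<mu> stays as the derivative of
  \<open>V *v \<xi>\<close> in the direction \<open>\<xi>\<^sub>\<mu>\<close>.\<close>

lemma dual_torsion_algebra:
  fixes V W :: "real^3^3" and dV dW :: "3 \<Rightarrow> real^3^3" and \<xi> :: "real^3"
  assumes VW: "\<And>j k. (\<Sum>\<beta>\<in>UNIV. V $ j $ \<beta> * W $ k $ \<beta>) = (if j = k then 1 else 0)"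
    and X: "\<And>\<mu> \<nu>. X \<mu> \<nu> = - (\<Sum>j\<in>UNIV. (\<Sum>\<delta>\<in>UNIV. dV \<mu> $ j $ \<delta> * \<xi> $ \<delta>) * W $ j $ \<nu>)"
  shows "det V * (\<Sum>\<beta>\<in>UNIV. \<xi> $ \<beta> * (\<Sum>\<mu>\<in>UNIV. \<Sum>\<nu>\<in>UNIV. levi_civita \<mu> \<nu> \<beta> * X \<mu> \<nu>)) =
    (\<Sum>\<mu>\<in>UNIV. triple_product (\<lambda>j. (V *v \<xi>) $ j) (\<lambda>j. (dV \<mu> *v \<xi>) $ j) (\<lambda>j. V $ j $ \<mu>))"
proof -
  \<comment> \<open>What is left of \<open>det V * levi_civita \<mu> \<nu> \<beta>\<close> after
    contracting \<nu> with the coframe covector number \<open>j\<close>.\<close>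
  define E where "E \<mu> j \<beta> = (\<Sum>a\<in>UNIV. \<Sum>c\<in>UNIV. levi_civita a j c * V $ a $ \<mu> * V $ c $ \<beta>)" for \<mu> j \<beta>
  have rearrange: "(\<Sum>\<nu>\<in>UNIV. (\<Sum>a\<in>UNIV. \<Sum>b\<in>UNIV. \<Sum>c\<in>UNIV. e a b c * f a * g b \<nu> * h c) * w \<nu>) =
      (\<Sum>a\<in>UNIV. \<Sum>b\<in>UNIV. \<Sum>c\<in>UNIV. e a b c * f a * (\<Sum>\<nu>\<in>UNIV. g b \<nu> * w \<nu>) * h c)"
    for e :: "3 \<Rightarrow> 3 \<Rightarrow> 3 \<Rightarrow> real" and f h w :: "3 \<Rightarrow> real" and g :: "3 \<Rightarrow> 3 \<Rightarrow> real"
  proof -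
    have "(\<Sum>\<nu>\<in>UNIV. (\<Sum>a\<in>UNIV. \<Sum>b\<in>UNIV. \<Sum>c\<in>UNIV. e a b c * f a * g b \<nu> * h c) * w \<nu>) =
        (\<Sum>a\<in>UNIV. \<Sum>b\<in>UNIV. \<Sum>c\<in>UNIV. \<Sum>\<nu>\<in>UNIV. e a b c * f a * g b \<nu> * h c * w \<nu>)"
      unfolding sum_distrib_right
      by (rule trans[OF sum.swap], rule sum.cong[OF refl], rule trans[OF sum.swap],
          rule sum.cong[OF refl], rule sum.swap)
    also have "\<dots> = (\<Sum>a\<in>UNIV. \<Sum>b\<in>UNIV. \<Sum>c\<in>UNIV. e a b c * f a * (\<Sum>\<nu>\<in>UNIV. g b \<nu> * w \<nu>) * h c)"
      by (simp add: sum_distrib_left sum_distrib_right mult_ac)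
    finally show ?thesis .
  qed
  have E: "(\<Sum>\<nu>\<in>UNIV. det V * levi_civita \<mu> \<nu> \<beta> * W $ j $ \<nu>) = E \<mu> j \<beta>" for \<mu> j \<beta>
    unfolding levi_civita_det[symmetric] rearrange VW E_def
    using exhaust_3[of j] by (auto simp: sum_3)
  have "det V * (\<Sum>\<beta>\<in>UNIV. \<xi> $ \<beta> * (\<Sum>\<mu>\<in>UNIV. \<Sum>\<nu>\<in>UNIV. levi_civita \<mu> \<nu> \<beta> * X \<mu> \<nu>)) =
      - (\<Sum>\<mu>\<in>UNIV. \<Sum>j\<in>UNIV. \<Sum>\<beta>\<in>UNIV. (dV \<mu> *v \<xi>) $ j * \<xi> $ \<beta> * (\<Sum>\<nu>\<in>UNIV. det V * levi_civita \<mu> \<nu> \<beta> * W $ j $ \<nu>))"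
  proof -
    have "X \<mu> \<nu> = - (\<Sum>j\<in>UNIV. (dV \<mu> *v \<xi>) $ j * W $ j $ \<nu>)" for \<mu> \<nu>
      unfolding X by (simp add: matrix_vector_mult_def)
    then have "det V * (\<Sum>\<beta>\<in>UNIV. \<xi> $ \<beta> * (\<Sum>\<mu>\<in>UNIV. \<Sum>\<nu>\<in>UNIV. levi_civita \<mu> \<nu> \<beta> * X \<mu> \<nu>)) =
      - (\<Sum>\<beta>\<in>UNIV. \<Sum>\<mu>\<in>UNIV. \<Sum>\<nu>\<in>UNIV. \<Sum>j\<in>UNIV.
          (dV \<mu> *v \<xi>) $ j * \<xi> $ \<beta> * (det V * levi_civita \<mu> \<nu> \<beta> * W $ j $ \<nu>))"
      by (simp add: sum_distrib_left sum_negf mult_ac)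
    also have "\<dots> = - (\<Sum>\<mu>\<in>UNIV. \<Sum>j\<in>UNIV. \<Sum>\<beta>\<in>UNIV. \<Sum>\<nu>\<in>UNIV.
          (dV \<mu> *v \<xi>) $ j * \<xi> $ \<beta> * (det V * levi_civita \<mu> \<nu> \<beta> * W $ j $ \<nu>))"
      by (rule arg_cong[of _ _ uminus], rule trans[OF sum.swap], rule sum.cong[OF refl],
          rule trans[OF sum.cong[OF refl sum.swap]], rule sum.swap)
    finally show ?thesis by (simp only: sum_distrib_left)
  qed
  also have "\<dots> = (\<Sum>\<mu>\<in>UNIV. - (\<Sum>a\<in>UNIV. \<Sum>b\<in>UNIV. \<Sum>c\<in>UNIV.
      levi_civita a b c * V $ a $ \<mu> * (dV \<mu> *v \<xi>) $ b * (V *v \<xi>) $ c))"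
  proof -
    have "(\<Sum>j\<in>UNIV. \<Sum>\<beta>\<in>UNIV. (dV \<mu> *v \<xi>) $ j * \<xi> $ \<beta> * E \<mu> j \<beta>) =
      (\<Sum>a\<in>UNIV. \<Sum>b\<in>UNIV. \<Sum>c\<in>UNIV. levi_civita a b c * V $ a $ \<mu> * (dV \<mu> *v \<xi>) $ b * (V *v \<xi>) $ c)" for \<mu>
      by (simp add: E_def matrix_vector_mult_def[of V] sum_3 levi_civita_def algebra_simps)
    then show ?thesis unfolding E by (simp add: sum_negf)
  qed
  finally show ?thesis unfolding levi_civita_triple_product by simp
qed

text \<open>The situation of differentiating m = h n: the derivatives of the length \<open>h\<close>
  contribute multiples of \<open>n\<close>, which a determinant with first row \<open>n\<close>
  ignores, and each of the three rows releases one factor \<open>h\<close>.\<close>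

lemma triple_product_scaled:
  assumes "\<And>j. m j = h * n j" "\<And>j. a j = a0 * n j + h * a' j" "\<And>j. b j = b0 * n j + h * b' j"
  shows "triple_product m a b = h ^ 3 * triple_product n a' b'"
  unfolding triple_product_def assms by (simp add: algebra_simps power3_eq_cube)

section \<open>Frame, metric and torsion of a symbol\<close>

lemma frame_nth:
  "frame s x $ 1 $ \<alpha> = Re (s x \<alpha> $ 1 $ 2)"
  "frame s x $ 2 $ \<alpha> = - Im (s x \<alpha> $ 1 $ 2)"
  "frame s x $ 3 $ \<alpha> = Re (s x \<alpha> $ 1 $ 1)"
  by (simp_all add: frame_def vector_3)

text \<open>\<open>P\<close> is Hermitian and trace-free, so its eigenvalues are h and -h and P = h
  (2 \<open>v v\<^sup>*\<close> - 1). By the definition of the Bloch vector this is the Pauli matrix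
  of the vector h n.\<close>

lemma eigenvector_bloch:
  fixes P :: "complex^2^2"
  assumes "P $ 1 $ 1 = of_real (m 3)" "P $ 1 $ 2 = Complex (m 1) (- m 2)"
    "P $ 2 $ 1 = Complex (m 1) (m 2)" "P $ 2 $ 2 = - of_real (m 3)"
    and eig: "P *v v = complex_of_real h *s v" and "norm v = 1"
  shows "m j = h * bloch v j"
proof -
  have unit: "(Re (v $ 1))\<^sup>2 + (Im (v $ 1))\<^sup>2 + (Re (v $ 2))\<^sup>2 + (Im (v $ 2))\<^sup>2 = 1"
    using norm_complex_pair[of v] assms(6) by simp
  have "(P *v v) $ i = complex_of_real h * v $ i" for i using eig by simp
  from this[of 1] this[of 2] have
    "m 3 * Re (v $ 1) + m 1 * Re (v $ 2) + m 2 * Im (v $ 2) = h * Re (v $ 1)"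
    "m 3 * Im (v $ 1) + m 1 * Im (v $ 2) - m 2 * Re (v $ 2) = h * Im (v $ 1)"
    "m 1 * Re (v $ 1) - m 2 * Im (v $ 1) - m 3 * Re (v $ 2) = h * Re (v $ 2)"
    "m 1 * Im (v $ 1) + m 2 * Re (v $ 1) - m 3 * Im (v $ 2) = h * Im (v $ 2)"
    unfolding matrix_vector_mult_def using assms(1-4) by (auto simp: sum_2 complex_eq_iff algebra_simps)
  then have "m 1 = h * (2 * (Re (v $ 1) * Re (v $ 2) + Im (v $ 1) * Im (v $ 2)))"
    "m 2 = h * (2 * (Re (v $ 1) * Im (v $ 2) - Im (v $ 1) * Re (v $ 2)))"
    "m 3 = h * ((Re (v $ 1))\<^sup>2 + (Im (v $ 1))\<^sup>2 - (Re (v $ 2))\<^sup>2 - (Im (v $ 2))\<^sup>2)"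
    using unit by algebra+
  then show ?thesis using exhaust_3[of j] by (auto simp: bloch_def)
qed

lemma bloch_unit:
  assumes "norm v = 1"
  shows "(\<Sum>j\<in>UNIV. bloch v j * bloch v j) = 1"
proof -
  have unit: "(Re (v $ 1))\<^sup>2 + (Im (v $ 1))\<^sup>2 + (Re (v $ 2))\<^sup>2 + (Im (v $ 2))\<^sup>2 = 1"
    using norm_complex_pair[of v] assms by simp
  have "(\<Sum>j\<in>UNIV. bloch v j * bloch v j) =
    ((Re (v $ 1))\<^sup>2 + (Im (v $ 1))\<^sup>2 + (Re (v $ 2))\<^sup>2 + (Im (v $ 2))\<^sup>2)\<^sup>2"
    by (simp add: sum_3 bloch_def power2_eq_square algebra_simps)
  then show ?thesis unfolding unit by simp
qed

lemma conj_row_has_derivative: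
  assumes "(v has_derivative D) (at p)"
  shows "(conj_row v has_derivative (\<lambda>e. \<chi> j. cnj (D e $ j))) (at p)"
proof -
  have "bounded_linear (\<lambda>w::complex^2. \<chi> j. cnj (w $ j))"
    unfolding linear_conv_bounded_linear[symmetric] by (rule linearI) (simp_all add: vec_eq_iff)
  from bounded_linear.has_derivative[OF this assms] show ?thesis
    by (simp add: conj_row_def[abs_def])
qed

lemma principal_symbol_axis: "principal_symbol s x (axis \<alpha> 1) = s x \<alpha>"
  by (simp add: principal_symbol_def axis_def if_distrib[of "\<lambda>t. t *\<^sub>R _"] cong: if_cong)

lemma frame_quadratic_form:
  "(\<Sum>\<alpha>\<in>UNIV. \<Sum>\<beta>\<in>UNIV. (transpose V ** V) $ \<alpha> $ \<beta> * \<xi> $ \<alpha> * \<xi> $ \<beta>) = (V *v \<xi>) \<bullet> (V *v \<xi>)"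
  for V :: "real^3^3"
  by (simp add: matrix_matrix_mult_def transpose_def matrix_vector_mult_def inner_vec_def sum_3 algebra_simps)

section \<open>A Hermitian, trace-free, elliptic symbol in one chart\<close>

locale trace_free_symbol_chart =
  fixes s :: "real^3 \<Rightarrow> 3 \<Rightarrow> complex^2^2" and U :: "(real^3) set"
  assumes open_domain: "open U"
    and smooth: "\<And>\<alpha>. smooth_on U (\<lambda>x. s x \<alpha>)"
    and hermitian: "\<And>x \<alpha> k l. x \<in> U \<Longrightarrow> cnj (s x \<alpha> $ l $ k) = s x \<alpha> $ k $ l"
    and trace_free: "\<And>x \<xi>. x \<in> U \<Longrightarrow> trace (principal_symbol s x \<xi>) = 0"
    and elliptic: "\<And>x \<xi>. x \<in> U \<Longrightarrow> \<xi> \<noteq> 0 \<Longrightarrow> det (principal_symbol s x \<xi>) \<noteq> 0"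
begin

lemma symbol_entries:
  assumes "x \<in> U"
  shows "s x \<alpha> $ 1 $ 1 = of_real (frame s x $ 3 $ \<alpha>)"
    "s x \<alpha> $ 1 $ 2 = Complex (frame s x $ 1 $ \<alpha>) (- frame s x $ 2 $ \<alpha>)"
    "s x \<alpha> $ 2 $ 1 = Complex (frame s x $ 1 $ \<alpha>) (frame s x $ 2 $ \<alpha>)"
    "s x \<alpha> $ 2 $ 2 = - of_real (frame s x $ 3 $ \<alpha>)"
proof -
  have "s x \<alpha> $ 1 $ 1 + s x \<alpha> $ 2 $ 2 = 0"
    using trace_free[OF assms, of "axis \<alpha> 1"] unfolding principal_symbol_axis trace_def by (simp add: sum_2)
  then show "s x \<alpha> $ 1 $ 1 = of_real (frame s x $ 3 $ \<alpha>)"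
    "s x \<alpha> $ 1 $ 2 = Complex (frame s x $ 1 $ \<alpha>) (- frame s x $ 2 $ \<alpha>)"
    "s x \<alpha> $ 2 $ 1 = Complex (frame s x $ 1 $ \<alpha>) (frame s x $ 2 $ \<alpha>)"
    "s x \<alpha> $ 2 $ 2 = - of_real (frame s x $ 3 $ \<alpha>)"
    using hermitian[OF assms, of \<alpha> 1 1] hermitian[OF assms, of \<alpha> 1 2] hermitian[OF assms, of \<alpha> 2 2]
    unfolding frame_nth complex_eq_iff by auto
qed

lemma principal_symbol_entries:
  assumes "x \<in> U"
  shows "principal_symbol s x \<xi> $ 1 $ 1 = of_real ((frame s x *v \<xi>) $ 3)"
    "principal_symbol s x \<xi> $ 1 $ 2 = Complex ((frame s x *v \<xi>) $ 1) (- (frame s x *v \<xi>) $ 2)"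
    "principal_symbol s x \<xi> $ 2 $ 1 = Complex ((frame s x *v \<xi>) $ 1) ((frame s x *v \<xi>) $ 2)"
    "principal_symbol s x \<xi> $ 2 $ 2 = - of_real ((frame s x *v \<xi>) $ 3)"
  by (simp_all add: principal_symbol_def matrix_vector_mult_def sum_3 symbol_entries[OF assms]
      complex_eq_iff algebra_simps)

lemma det_principal_symbol:
  "x \<in> U \<Longrightarrow> det (principal_symbol s x \<xi>) = - of_real ((frame s x *v \<xi>) \<bullet> (frame s x *v \<xi>))"
  unfolding det_2 principal_symbol_entries
  by (simp add: inner_vec_def sum_3 complex_eq_iff algebra_simps)

text \<open>The determinant of the symbol is minus the squared length of
  \<open>frame s x *v \<xi>\<close>, so ellipticity says exactly that the frame matrix has trivial
  kernel.\<close>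

lemma det_frame_nonzero:
  assumes "x \<in> U"
  shows "det (frame s x) \<noteq> 0"
proof -
  have "\<xi> = 0" if "frame s x *v \<xi> = 0" for \<xi>
    using elliptic[OF assms, of \<xi>] that unfolding det_principal_symbol[OF assms] by auto
  then have "invertible (frame s x)"
    unfolding invertible_left_inverse matrix_left_invertible_ker by blast
  then show ?thesis by (simp add: invertible_det_nz)
qed

text \<open>Orthonormality of the frame in matrix form. The definite description is legitimate since
  a symmetric matrix is determined by its quadratic form.\<close>

lemma inv_metric_eq:
  assumes "x \<in> U"
  shows "inv_metric s x = transpose (frame s x) ** frame s x" (is "_ = ?G")
  unfolding inv_metric_def
proof (rule the_equality)
  have sym: "transpose ?G = ?G" by (simp add: matrix_transpose_mul)
  then show "transpose ?G = ?G \<and> (\<forall>\<xi>. det (principal_symbol s x \<xi>) =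
        - complex_of_real (\<Sum>\<alpha>\<in>UNIV. \<Sum>\<beta>\<in>UNIV. ?G $ \<alpha> $ \<beta> * \<xi> $ \<alpha> * \<xi> $ \<beta>))"
    unfolding frame_quadratic_form det_principal_symbol[OF assms] by simp
  fix G assume G: "transpose G = G \<and> (\<forall>\<xi>. det (principal_symbol s x \<xi>) =
        - complex_of_real (\<Sum>\<alpha>\<in>UNIV. \<Sum>\<beta>\<in>UNIV. G $ \<alpha> $ \<beta> * \<xi> $ \<alpha> * \<xi> $ \<beta>))"
  have "(\<Sum>\<alpha>\<in>UNIV. \<Sum>\<beta>\<in>UNIV. G $ \<alpha> $ \<beta> * \<xi> $ \<alpha> * \<xi> $ \<beta>) =
      (\<Sum>\<alpha>\<in>UNIV. \<Sum>\<beta>\<in>UNIV. ?G $ \<alpha> $ \<beta> * \<xi> $ \<alpha> * \<xi> $ \<beta>)" for \<xi> :: "real^3"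
    using G unfolding frame_quadratic_form det_principal_symbol[OF assms] neg_equal_iff_equal of_real_eq_iff by simp
  moreover have "transpose (G - ?G) = G - ?G"
    using G sym by (simp add: vec_eq_iff transpose_def)
  ultimately have "G - ?G = 0"
    by (intro symmetric_quadratic_form_eq_0) (simp_all add: left_diff_distrib sum_subtractf)
  then show "G = ?G" by simp
qed

lemma det_inv_metric: "x \<in> U \<Longrightarrow> det (inv_metric s x) = (det (frame s x))\<^sup>2"
  by (simp add: inv_metric_eq det_mul power2_eq_square)

lemma metric_right_inverse: "x \<in> U \<Longrightarrow> inv_metric s x ** metric s x = mat 1"
proof -
  assume "x \<in> U"
  then have "invertible (inv_metric s x)"
    using det_inv_metric det_frame_nonzero by (simp add: invertible_det_nz)
  then show ?thesis
    unfolding metric_def matrix_inv_def invertible_def by (rule someI2_ex) blast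
qed

lemma det_metric:
  assumes "x \<in> U"
  shows "det (metric s x) = inverse ((det (frame s x))\<^sup>2)"
proof -
  have "det (inv_metric s x) * det (metric s x) = 1"
    using metric_right_inverse[OF assms] by (metis det_I det_mul)
  then show ?thesis unfolding det_inv_metric[OF assms] by (simp add: inverse_unique)
qed

text \<open>Raising the index of the coframe covector \<open>k\<close> returns the vector number
  \<open>k\<close>, that is, the transposed frame matrix applied to \<open>axis k 1\<close>. As the
  inverse metric is the transposed frame times the frame, the invertible transposed factor can be
  cancelled.\<close>

lemma frame_coframe:
  assumes "x \<in> U"
  shows "frame s x *v (coframe s x $ k) = axis k 1"
proof -
  let ?V = "frame s x"
  have "coframe s x $ k = metric s x *v (?V $ k)"
    by (simp add: coframe_def vec_eq_iff matrix_vector_mult_def)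
  then have "inv_metric s x *v (coframe s x $ k) = ?V $ k"
    using metric_right_inverse[OF assms] by (simp add: matrix_vector_mul_assoc)
  then have "transpose ?V *v (?V *v (coframe s x $ k)) = transpose ?V *v axis k 1"
    unfolding inv_metric_eq[OF assms]
    by (simp add: matrix_vector_mul_assoc matrix_vector_mult_basis column_transpose row_def vec_eq_iff)
  moreover have "invertible (transpose ?V)"
    using det_frame_nonzero[OF assms] by (simp add: invertible_det_nz)
  then obtain B where "B ** transpose ?V = mat 1" by (auto simp: invertible_def)
  ultimately show ?thesis
    by (metis matrix_vector_mul_assoc matrix_vector_mul_lid)
qed

lemma frame_coframe_sum:
  assumes "x \<in> U"
  shows "(\<Sum>\<beta>\<in>UNIV. frame s x $ j $ \<beta> * coframe s x $ k $ \<beta>) = (if j = k then 1 else 0)"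
  using frame_coframe[OF assms, of k] by (simp add: vec_eq_iff matrix_vector_mult_def axis_def)

lemma coframe_frame_sum:
  assumes "x \<in> U"
  shows "(\<Sum>k\<in>UNIV. coframe s x $ k $ \<beta> * frame s x $ k $ \<alpha>) = (if \<alpha> = \<beta> then 1 else 0)"
proof -
  have "frame s x ** transpose (coframe s x) = mat 1"
    using frame_coframe_sum[OF assms] by (simp add: vec_eq_iff matrix_matrix_mult_def transpose_def mat_def)
  then have "transpose (coframe s x) ** frame s x = mat 1" using matrix_left_right_inverse by blast
  then have "(transpose (coframe s x) ** frame s x) $ \<beta> $ \<alpha> = mat 1 $ \<beta> $ \<alpha>" by simp
  then show ?thesis by (auto simp: matrix_matrix_mult_def transpose_def mat_def)
qed

text \<open>Serves the smoothness of the coframe: its entries become quotients of determinants in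
  the entries of the frame.\<close>

lemma coframe_cramer:
  assumes "x \<in> U"
  shows "coframe s x $ k $ \<beta> =
    det (\<chi> i j. if j = \<beta> then axis k 1 $ i else frame s x $ i $ j) * inverse (det (frame s x))"
  using cramer[OF det_frame_nonzero[OF assms], of "coframe s x $ k" "axis k 1"] frame_coframe[OF assms, of k]
  by (simp add: vec_eq_iff divide_inverse)

lemma smooth_on_symbol_nth: "smooth_on U (\<lambda>x. s x \<alpha> $ i $ j)"
  by (intro smooth_on_nth open_domain smooth)

lemma smooth_on_frame: "smooth_on U (\<lambda>x. frame s x $ j $ \<alpha>)"
proof -
  have "smooth_on U (\<lambda>x. Re (s x \<alpha> $ i $ j))" "smooth_on U (\<lambda>x. Im (s x \<alpha> $ i $ j))" for i j
    by (rule smooth_on_bounded_linear_compose[OF open_domain bounded_linear_Re smooth_on_symbol_nth]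
        smooth_on_bounded_linear_compose[OF open_domain bounded_linear_Im smooth_on_symbol_nth])+
  then show ?thesis
    using exhaust_3[of j] by (auto simp: frame_nth intro!: smooth_on_minus[OF open_domain])
qed

lemma smooth_on_coframe: "smooth_on U (\<lambda>x. coframe s x $ k $ \<beta>)"
proof -
  have "smooth_on U (\<lambda>x. det (\<chi> i j. if j = \<beta> then axis k 1 $ i else frame s x $ i $ j) * inverse (det (frame s x)))"
  proof (intro smooth_on_mult[OF open_domain] smooth_on_inverse[OF open_domain] smooth_on_det_3[OF open_domain])
    show "smooth_on U (\<lambda>x. (\<chi> i j. if j = \<beta> then axis k 1 $ i else frame s x $ i $ j) $ i $ j)" for i j
      by (cases "j = \<beta>") (simp_all add: smooth_on_const open_domain smooth_on_frame)
  qed (auto simp: smooth_on_frame det_frame_nonzero)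
  then show ?thesis 
    by (subst smooth_on_cong[OF open_domain coframe_cramer])
qed

section \<open>The torsion as a sum of triple products\<close>

definition frame_derivative :: "real^3 \<Rightarrow> 3 \<Rightarrow> real^3^3" where
  "frame_derivative x \<mu> = (\<chi> j \<beta>. frechet_derivative (\<lambda>y. frame s y $ j $ \<beta>) (at x) (axis \<mu> 1))"

lemma teleparallel_contracted:
  assumes "x \<in> U"
  shows "(\<Sum>\<alpha>\<in>UNIV. \<xi> $ \<alpha> * teleparallel s x \<alpha> \<mu> \<nu>) =
    - (\<Sum>j\<in>UNIV. (\<Sum>\<delta>\<in>UNIV. frame_derivative x \<mu> $ j $ \<delta> * \<xi> $ \<delta>) * coframe s x $ j $ \<nu>)"
proof -
  let ?DV = "\<lambda>k \<alpha>. frechet_derivative (\<lambda>y. frame s y $ k $ \<alpha>) (at x)"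
  let ?DW = "\<lambda>k. frechet_derivative (\<lambda>y. coframe s y $ k $ \<nu>) (at x)"
  have "((\<lambda>y. \<Sum>k\<in>UNIV. (\<Sum>\<alpha>\<in>UNIV. \<xi> $ \<alpha> * frame s y $ k $ \<alpha>) * coframe s y $ k $ \<nu>) has_derivative
    (\<lambda>e. \<Sum>k\<in>UNIV. (\<Sum>\<alpha>\<in>UNIV. \<xi> $ \<alpha> * frame s x $ k $ \<alpha>) * ?DW k e
      + (\<Sum>\<alpha>\<in>UNIV. \<xi> $ \<alpha> * ?DV k \<alpha> e) * coframe s x $ k $ \<nu>)) (at x)"
    by (intro has_derivative_sum has_derivative_mult has_derivative_mult_right
        smooth_onD_has_derivative[OF smooth_on_frame assms] smooth_onD_has_derivative[OF smooth_on_coframe assms])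
  \<comment> \<open>Frame and coframe are dual at every base point, so with \<xi> held fixed the
    differentiated function is constant in \<open>y\<close>.\<close>
  moreover have "(\<Sum>k\<in>UNIV. (\<Sum>\<alpha>\<in>UNIV. \<xi> $ \<alpha> * frame s y $ k $ \<alpha>) * coframe s y $ k $ \<nu>) = \<xi> $ \<nu>"
    if "y \<in> U" for y
  proof -
    have "(\<Sum>k\<in>UNIV. (\<Sum>\<alpha>\<in>UNIV. \<xi> $ \<alpha> * frame s y $ k $ \<alpha>) * coframe s y $ k $ \<nu>) =
      (\<Sum>\<alpha>\<in>UNIV. \<xi> $ \<alpha> * (\<Sum>k\<in>UNIV. coframe s y $ k $ \<nu> * frame s y $ k $ \<alpha>))"
      by (simp add: sum_3 algebra_simps)
    then show ?thesis
      unfolding coframe_frame_sum[OF that] by (simp add: if_distrib[of "\<lambda>t. _ * t"] cong: if_cong)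
  qed
  ultimately have "((\<lambda>y. \<xi> $ \<nu>) has_derivative
    (\<lambda>e. \<Sum>k\<in>UNIV. (\<Sum>\<alpha>\<in>UNIV. \<xi> $ \<alpha> * frame s x $ k $ \<alpha>) * ?DW k e
      + (\<Sum>\<alpha>\<in>UNIV. \<xi> $ \<alpha> * ?DV k \<alpha> e) * coframe s x $ k $ \<nu>)) (at x)"
    by (rule has_derivative_transform_within_open[OF _ open_domain assms])
  then have "(\<lambda>e. \<Sum>k\<in>UNIV. (\<Sum>\<alpha>\<in>UNIV. \<xi> $ \<alpha> * frame s x $ k $ \<alpha>) * ?DW k e
      + (\<Sum>\<alpha>\<in>UNIV. \<xi> $ \<alpha> * ?DV k \<alpha> e) * coframe s x $ k $ \<nu>) = (\<lambda>e. 0)"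
    using has_derivative_unique[OF _ has_derivative_const] by blast
  from fun_cong[OF this, of "axis \<mu> 1"]
  have "(\<Sum>k\<in>UNIV. (\<Sum>\<alpha>\<in>UNIV. \<xi> $ \<alpha> * frame s x $ k $ \<alpha>) * ?DW k (axis \<mu> 1)) =
      - (\<Sum>k\<in>UNIV. (\<Sum>\<alpha>\<in>UNIV. \<xi> $ \<alpha> * ?DV k \<alpha> (axis \<mu> 1)) * coframe s x $ k $ \<nu>)"
    unfolding sum.distrib by (rule eq_neg_iff_add_eq_0[THEN iffD2])
  moreover have "(\<Sum>\<alpha>\<in>UNIV. \<xi> $ \<alpha> * teleparallel s x \<alpha> \<mu> \<nu>) =
      (\<Sum>k\<in>UNIV. (\<Sum>\<alpha>\<in>UNIV. \<xi> $ \<alpha> * frame s x $ k $ \<alpha>) * ?DW k (axis \<mu> 1))"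
    unfolding teleparallel_def by (simp add: sum_3 algebra_simps)
  ultimately show ?thesis
    by (simp add: frame_derivative_def mult.commute)
qed

text \<open>After raising, all three indices of the permutation symbol carry a factor of the inverse
  metric, which together amount to its determinant. Contraction with the antisymmetric symbol makes
  both halves of the torsion equal, which absorbs the factor 1/2 of the Hodge dual.\<close>

lemma dual_torsion_raised_eq:
  assumes "x \<in> U"
  shows "dual_torsion_raised s x \<alpha> \<beta> = sqrt (det (metric s x)) * det (inv_metric s x) *
    (\<Sum>\<mu>\<in>UNIV. \<Sum>\<nu>\<in>UNIV. levi_civita \<mu> \<nu> \<beta> * teleparallel s x \<alpha> \<mu> \<nu>)"
proof -
  let ?G = "inv_metric s x" and ?T = "torsion s x \<alpha>" and ?q = "sqrt (det (metric s x))"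
  have "dual_torsion_raised s x \<alpha> \<beta> = 1 / 2 * ?q * (\<Sum>\<mu>\<in>UNIV. \<Sum>\<nu>\<in>UNIV. ?T \<mu> \<nu> *
      (\<Sum>a\<in>UNIV. \<Sum>b\<in>UNIV. \<Sum>c\<in>UNIV. levi_civita a b c * ?G $ a $ \<mu> * ?G $ b $ \<nu> * ?G $ c $ \<beta>))"
  proof -
    have rotate: "(\<Sum>a\<in>UNIV. \<Sum>b\<in>UNIV. \<Sum>c\<in>UNIV. \<Sum>d\<in>UNIV. \<Sum>e\<in>UNIV. f a b c d e) =
        (\<Sum>b\<in>UNIV. \<Sum>c\<in>UNIV. \<Sum>d\<in>UNIV. \<Sum>e\<in>UNIV. \<Sum>a\<in>UNIV. f a b c d e)"
      for f :: "3 \<Rightarrow> 3 \<Rightarrow> 3 \<Rightarrow> 3 \<Rightarrow> 3 \<Rightarrow> real"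
      by (rule trans[OF sum.swap], rule sum.cong[OF refl], rule trans[OF sum.swap], rule sum.cong[OF refl],
          rule trans[OF sum.swap], rule sum.cong[OF refl], rule sum.swap)
    let ?f = "\<lambda>a b c \<mu> \<nu>. ?T \<mu> \<nu> * (levi_civita a b c * ?G $ a $ \<mu> * ?G $ b $ \<nu> * ?G $ c $ \<beta>)"
    have "dual_torsion_raised s x \<alpha> \<beta> =
        1 / 2 * ?q * (\<Sum>c\<in>UNIV. \<Sum>a\<in>UNIV. \<Sum>b\<in>UNIV. \<Sum>\<mu>\<in>UNIV. \<Sum>\<nu>\<in>UNIV. ?f a b c \<mu> \<nu>)"
      unfolding dual_torsion_raised_def dual_torsion_def torsion_raised_def
      by (simp only: sum_distrib_left sum_distrib_right mult_ac)
    \<comment> \<open>Each \<open>rotate\<close> moves the outermost of five sums to the innermost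
      place, so three of them bring \<mu> and \<nu> to the front.\<close>
    also have "(\<Sum>c\<in>UNIV. \<Sum>a\<in>UNIV. \<Sum>b\<in>UNIV. \<Sum>\<mu>\<in>UNIV. \<Sum>\<nu>\<in>UNIV. ?f a b c \<mu> \<nu>) =
        (\<Sum>\<mu>\<in>UNIV. \<Sum>\<nu>\<in>UNIV. \<Sum>c\<in>UNIV. \<Sum>a\<in>UNIV. \<Sum>b\<in>UNIV. ?f a b c \<mu> \<nu>)"
      by (rule trans[OF rotate trans[OF rotate rotate]])
    also have "\<dots> = (\<Sum>\<mu>\<in>UNIV. \<Sum>\<nu>\<in>UNIV. \<Sum>a\<in>UNIV. \<Sum>b\<in>UNIV. \<Sum>c\<in>UNIV. ?f a b c \<mu> \<nu>)"
      by (rule sum.cong[OF refl], rule sum.cong[OF refl], rule trans[OF sum.swap], rule sum.cong[OF refl],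
          rule sum.swap)
    finally show ?thesis by (simp only: sum_distrib_left)
  qed
  also have "\<dots> = ?q * det ?G * (1 / 2 * (\<Sum>\<mu>\<in>UNIV. \<Sum>\<nu>\<in>UNIV. levi_civita \<mu> \<nu> \<beta> * ?T \<mu> \<nu>))"
    unfolding levi_civita_det by (simp add: sum_distrib_left mult_ac)
  also have "(\<Sum>\<mu>\<in>UNIV. \<Sum>\<nu>\<in>UNIV. levi_civita \<mu> \<nu> \<beta> * ?T \<mu> \<nu>) =
      2 * (\<Sum>\<mu>\<in>UNIV. \<Sum>\<nu>\<in>UNIV. levi_civita \<mu> \<nu> \<beta> * teleparallel s x \<alpha> \<mu> \<nu>)"
    using exhaust_3[of \<beta>] by (auto simp: torsion_def sum_3 levi_civita_def)
  finally show ?thesis by simp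
qed

text \<open>The volume factor is 1 / |det V| and the determinant of the inverse metric is (det V)^2.
  Their product |det V| becomes, through the sign of the relative orientation, the factor det V that
  \<open>dual_torsion_algebra\<close> requires.\<close>

lemma dual_torsion_quadratic_form:
  assumes "x \<in> U"
  shows "sgn (det (frame s x)) * (\<Sum>\<alpha>\<in>UNIV. \<Sum>\<beta>\<in>UNIV. dual_torsion_raised s x \<alpha> \<beta> * \<xi> $ \<alpha> * \<xi> $ \<beta>) =
    (\<Sum>\<mu>\<in>UNIV. triple_product (\<lambda>j. (frame s x *v \<xi>) $ j) (\<lambda>j. (frame_derivative x \<mu> *v \<xi>) $ j)
       (\<lambda>j. frame s x $ j $ \<mu>))"
proof -
  let ?d = "det (frame s x)"
  have "?d \<noteq> 0" using det_frame_nonzero[OF assms] .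
  then have d: "sgn ?d * (sqrt (det (metric s x)) * det (inv_metric s x)) = ?d"
    unfolding det_metric[OF assms] det_inv_metric[OF assms]
    by (cases "?d > 0") (simp_all add: real_sqrt_inverse power2_eq_square)
  have "(\<Sum>\<alpha>\<in>UNIV. \<Sum>\<beta>\<in>UNIV. dual_torsion_raised s x \<alpha> \<beta> * \<xi> $ \<alpha> * \<xi> $ \<beta>) =
    sqrt (det (metric s x)) * det (inv_metric s x) * (\<Sum>\<beta>\<in>UNIV. \<xi> $ \<beta> * (\<Sum>\<mu>\<in>UNIV. \<Sum>\<nu>\<in>UNIV.
      levi_civita \<mu> \<nu> \<beta> * (\<Sum>\<alpha>\<in>UNIV. \<xi> $ \<alpha> * teleparallel s x \<alpha> \<mu> \<nu>)))"
  proof -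
    have "(\<Sum>\<mu>\<in>UNIV. \<Sum>\<nu>\<in>UNIV. levi_civita \<mu> \<nu> \<beta> * (\<Sum>\<alpha>\<in>UNIV. \<xi> $ \<alpha> * teleparallel s x \<alpha> \<mu> \<nu>)) =
      (\<Sum>\<alpha>\<in>UNIV. \<xi> $ \<alpha> * (\<Sum>\<mu>\<in>UNIV. \<Sum>\<nu>\<in>UNIV. levi_civita \<mu> \<nu> \<beta> * teleparallel s x \<alpha> \<mu> \<nu>))" for \<beta>
      using exhaust_3[of \<beta>] by (auto simp: sum_3 levi_civita_def algebra_simps)
    then show ?thesis
      unfolding dual_torsion_raised_eq[OF assms] by (simp add: sum_3 algebra_simps)
  qed
  then have "sgn ?d * (\<Sum>\<alpha>\<in>UNIV. \<Sum>\<beta>\<in>UNIV. dual_torsion_raised s x \<alpha> \<beta> * \<xi> $ \<alpha> * \<xi> $ \<beta>) =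
    sgn ?d * (sqrt (det (metric s x)) * det (inv_metric s x)) * (\<Sum>\<beta>\<in>UNIV. \<xi> $ \<beta> * (\<Sum>\<mu>\<in>UNIV. \<Sum>\<nu>\<in>UNIV.
      levi_civita \<mu> \<nu> \<beta> * (\<Sum>\<alpha>\<in>UNIV. \<xi> $ \<alpha> * teleparallel s x \<alpha> \<mu> \<nu>)))"
    by (simp only: mult.assoc)
  also have "\<dots> = (\<Sum>\<mu>\<in>UNIV. triple_product (\<lambda>j. (frame s x *v \<xi>) $ j)
      (\<lambda>j. (frame_derivative x \<mu> *v \<xi>) $ j) (\<lambda>j. frame s x $ j $ \<mu>))"
    unfolding d
    by (rule dual_torsion_algebra[OF frame_coframe_sum[OF assms] teleparallel_contracted[OF assms]])
  finally show ?thesis .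
qed

section \<open>The bracket of the eigenvector\<close>

lemma frame_covector_has_derivative:
  assumes "x \<in> U"
  shows "((\<lambda>q. (frame s (fst q) *v snd q) $ j) has_derivative
    (\<lambda>e. \<Sum>\<alpha>\<in>UNIV. frame s x $ j $ \<alpha> * snd e $ \<alpha>
      + frechet_derivative (\<lambda>y. frame s y $ j $ \<alpha>) (at x) (fst e) * \<xi> $ \<alpha>)) (at (x, \<xi>))"
proof -
  have fst: "((\<lambda>q. frame s (fst q) $ j $ \<alpha>) has_derivative
    (\<lambda>e. frechet_derivative (\<lambda>y. frame s y $ j $ \<alpha>) (at x) (fst e))) (at (x, \<xi>))" for \<alpha>
    using has_derivative_compose[OF has_derivative_fst[OF has_derivative_ident], of
        "\<lambda>y. frame s y $ j $ \<alpha>" _ "(x, \<xi>)"] smooth_onD_has_derivative[OF smooth_on_frame assms] by simp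
  have snd: "((\<lambda>q. snd q $ \<alpha>) has_derivative (\<lambda>e. snd e $ \<alpha>)) (at (x, \<xi>))" for \<alpha> :: 3
    by (rule bounded_linear.has_derivative[OF bounded_linear_vec_nth has_derivative_snd[OF has_derivative_ident]])
  have "((\<lambda>q. \<Sum>\<alpha>\<in>UNIV. frame s (fst q) $ j $ \<alpha> * snd q $ \<alpha>) has_derivative
    (\<lambda>e. \<Sum>\<alpha>\<in>UNIV. frame s x $ j $ \<alpha> * snd e $ \<alpha>
      + frechet_derivative (\<lambda>y. frame s y $ j $ \<alpha>) (at x) (fst e) * \<xi> $ \<alpha>)) (at (x, \<xi>))"
    using has_derivative_sum[of UNIV, OF has_derivative_mult[OF fst snd]] by simp
  then show ?thesis by (simp add: matrix_vector_mult_def)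
qed

lemma poisson_bracket_eigenvector:
  assumes W: "open W" "(x, \<xi>) \<in> W" "W \<subseteq> U \<times> (UNIV - {0})" and v: "local_positive_eigenvector s W v"
  shows "- \<i> * poisson_bracket (conj_row v) v (x, \<xi>) =
    complex_of_real (sgn (det (frame s x)) / 2 *
      (\<Sum>\<alpha>\<in>UNIV. \<Sum>\<beta>\<in>UNIV. dual_torsion_raised s x \<alpha> \<beta> * \<xi> $ \<alpha> * \<xi> $ \<beta>) /
      (\<Sum>\<mu>\<in>UNIV. \<Sum>\<nu>\<in>UNIV. inv_metric s x $ \<mu> $ \<nu> * \<xi> $ \<mu> * \<xi> $ \<nu>) powr (3 / 2))"
proof -
  let ?p = "(x, \<xi>)"
  let ?D = "frechet_derivative v (at ?p)"
  define m where "m q j = (frame s (fst q) *v snd q) $ j" for q j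
  define n where "n q j = bloch (v q) j" for q j
  \<comment> \<open>On \<open>W\<close> this is the positive eigenvalue, which the definition of
    \<open>v\<close> supplies only pointwise. As the inner product of m and n it is visibly
    differentiable.\<close>
  define h where "h q = (\<Sum>j\<in>UNIV. m q j * n q j)" for q
  have x: "x \<in> U" using W by blast
  have Dv: "(v has_derivative ?D) (at ?p)"
    using v smooth_onD_has_derivative[OF _ W(2), of v] by (simp add: local_positive_eigenvector_def)
  have unit: "norm (v q) = 1" if "q \<in> W" for q
    using v that unfolding local_positive_eigenvector_def by auto
  have nn: "(\<Sum>j\<in>UNIV. n q j * n q j) = 1" if "q \<in> W" for q
    unfolding n_def using bloch_unit[OF unit[OF that]] .
  have m: "h q > 0 \<and> (\<forall>j. m q j = h q * n q j)" if q: "q \<in> W" for q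
  proof -
    obtain y \<eta> where q': "q = (y, \<eta>)" by force
    with q W(3) have y: "y \<in> U" by blast
    obtain k where k: "k > 0" "principal_symbol s y \<eta> *v v q = complex_of_real k *s v q"
      using v q unfolding local_positive_eigenvector_def q' by auto
    have mk: "m q j = k * n q j" for j
      unfolding n_def
      by (rule eigenvector_bloch[OF _ _ _ _ k(2) unit[OF q]])
        (simp_all add: m_def q' principal_symbol_entries[OF y])
    have "h q = k * (\<Sum>j\<in>UNIV. n q j * n q j)"
      unfolding h_def mk by (simp add: sum_distrib_left mult.assoc)
    then show ?thesis using mk k(1) nn[OF q] by simp
  qed
  define Dm where "Dm e j = (\<Sum>\<alpha>\<in>UNIV. frame s x $ j $ \<alpha> * snd e $ \<alpha>
      + frechet_derivative (\<lambda>y. frame s y $ j $ \<alpha>) (at x) (fst e) * \<xi> $ \<alpha>)" for e j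
  define Dn where "Dn e j = bloch_deriv (v ?p) (?D e) j" for e j
  define Dh where "Dh e = (\<Sum>j\<in>UNIV. m ?p j * Dn e j + Dm e j * n ?p j)" for e
  have der_m: "((\<lambda>q. m q j) has_derivative (\<lambda>e. Dm e j)) (at ?p)" for j
    unfolding m_def Dm_def by (rule frame_covector_has_derivative[OF x])
  have der_n: "((\<lambda>q. n q j) has_derivative (\<lambda>e. Dn e j)) (at ?p)" for j
    unfolding n_def Dn_def by (rule bloch_has_derivative[OF Dv])
  have der_h: "(h has_derivative Dh) (at ?p)"
    unfolding h_def[abs_def] Dh_def[abs_def]
    by (rule has_derivative_sum[OF has_derivative_mult[OF der_m der_n]])
  \<comment> \<open>The identity m = h n holds on the open set \<open>W\<close>, so it may be
    differentiated at \<open>?p\<close>.\<close>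
  have Dm: "Dm e j = Dh e * n ?p j + h ?p * Dn e j" for e j
  proof -
    have "((\<lambda>q. m q j) has_derivative (\<lambda>e. h ?p * Dn e j + Dh e * n ?p j)) (at ?p)"
      by (rule has_derivative_transform_within_open[OF has_derivative_mult[OF der_h der_n] W(1,2)])
        (use m in auto)
    from has_derivative_unique[OF der_m this] show ?thesis by (metis add.commute)
  qed
  have triple: "triple_product (n ?p) (Dn e) (Dn f) = triple_product (m ?p) (Dm e) (Dm f) / h ?p ^ 3" for e f
    using triple_product_scaled[of "m ?p" "h ?p" "n ?p" "Dm e" "Dh e" "Dn e" "Dm f" "Dh f" "Dn f"]
      Dm m[OF W(2)] by simp
  \<comment> \<open>Constancy of the norm gives orthogonality for the real inner product only; a
    component along \<open>i v\<close> may remain.\<close>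
  have orth: "v ?p \<bullet> ?D e = 0" for e
  proof -
    have "((\<lambda>q. v q \<bullet> v q) has_derivative (\<lambda>e. v ?p \<bullet> ?D e + ?D e \<bullet> v ?p)) (at ?p)"
      by (rule has_derivative_inner[OF Dv Dv])
    moreover have "v q \<bullet> v q = 1" if "q \<in> W" for q
      using unit[OF that] by (simp add: dot_square_norm)
    ultimately have "((\<lambda>q. 1 :: real) has_derivative (\<lambda>e. v ?p \<bullet> ?D e + ?D e \<bullet> v ?p)) (at ?p)"
      by (rule has_derivative_transform_within_open[OF _ W(1,2)])
    from fun_cong[OF has_derivative_unique[OF this has_derivative_const], of e]
    show ?thesis by (simp add: inner_commute)
  qed
  have Dm_x: "Dm (axis \<alpha> 1, 0) = (\<lambda>j. (frame_derivative x \<alpha> *v \<xi>) $ j)" for \<alpha>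
    by (simp add: fun_eq_iff Dm_def frame_derivative_def matrix_vector_mult_def)
  have Dm_\<xi>: "Dm (0, axis \<alpha> 1) = (\<lambda>j. frame s x $ j $ \<alpha>)" for \<alpha>
  proof -
    have "frechet_derivative (\<lambda>y. frame s y $ j $ \<beta>) (at x) 0 = 0" for j \<beta>
      using linear_0[OF has_derivative_linear[OF smooth_onD_has_derivative[OF smooth_on_frame x]]] .
    then show ?thesis
      by (simp add: fun_eq_iff Dm_def axis_def if_distrib[of "\<lambda>t. _ * t"] cong: if_cong)
  qed
  have "frechet_derivative (conj_row v) (at ?p) e = (\<chi> j. cnj (?D e $ j))" for e
    using frechet_derivative_at[OF conj_row_has_derivative[OF Dv]] by metis
  then have "- \<i> * poisson_bracket (conj_row v) v ?p = (\<Sum>\<alpha>\<in>UNIV. - \<i> *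
      (row_times_column (\<chi> j. cnj (?D (axis \<alpha> 1, 0) $ j)) (?D (0, axis \<alpha> 1))
       - row_times_column (\<chi> j. cnj (?D (0, axis \<alpha> 1) $ j)) (?D (axis \<alpha> 1, 0))))"
    unfolding poisson_bracket_def by (simp only: sum_distrib_left)
  also have "\<dots> = (\<Sum>\<alpha>\<in>UNIV. complex_of_real (1 / 2 *
      triple_product (n ?p) (Dn (axis \<alpha> 1, 0)) (Dn (0, axis \<alpha> 1))))"
    unfolding row_times_column_bloch[OF unit[OF W(2)] orth orth] n_def Dn_def ..
  also have "\<dots> = complex_of_real (1 / 2 * (\<Sum>\<alpha>\<in>UNIV.
      triple_product (m ?p) (Dm (axis \<alpha> 1, 0)) (Dm (0, axis \<alpha> 1))) / h ?p ^ 3)"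
    unfolding triple by (simp add: sum_distrib_left sum_divide_distrib)
  also have "(\<Sum>\<alpha>\<in>UNIV. triple_product (m ?p) (Dm (axis \<alpha> 1, 0)) (Dm (0, axis \<alpha> 1))) =
      sgn (det (frame s x)) * (\<Sum>\<alpha>\<in>UNIV. \<Sum>\<beta>\<in>UNIV. dual_torsion_raised s x \<alpha> \<beta> * \<xi> $ \<alpha> * \<xi> $ \<beta>)"
    unfolding dual_torsion_quadratic_form[OF x] Dm_x Dm_\<xi> m_def by simp
  \<comment> \<open>Since n is a unit vector, the quadratic form of the inverse metric at \<xi> is
    |m|^2 = h^2, and positivity of h identifies its power 3/2 with the cube.\<close>
  also have "h ?p ^ 3 = (\<Sum>\<mu>\<in>UNIV. \<Sum>\<nu>\<in>UNIV. inv_metric s x $ \<mu> $ \<nu> * \<xi> $ \<mu> * \<xi> $ \<nu>) powr (3 / 2)"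
  proof -
    have "(\<Sum>\<mu>\<in>UNIV. \<Sum>\<nu>\<in>UNIV. inv_metric s x $ \<mu> $ \<nu> * \<xi> $ \<mu> * \<xi> $ \<nu>) = (\<Sum>j\<in>UNIV. m ?p j * m ?p j)"
      unfolding inv_metric_eq[OF x] frame_quadratic_form by (simp add: m_def inner_vec_def)
    also have "\<dots> = (h ?p)\<^sup>2 * (\<Sum>j\<in>UNIV. n ?p j * n ?p j)"
      using m[OF W(2)] by (simp add: sum_distrib_left power2_eq_square mult_ac)
    also have "\<dots> = h ?p powr 2" using nn[OF W(2)] m[OF W(2)] by simp
    finally have "(\<Sum>\<mu>\<in>UNIV. \<Sum>\<nu>\<in>UNIV. inv_metric s x $ \<mu> $ \<nu> * \<xi> $ \<mu> * \<xi> $ \<nu>) powr (3 / 2) = h ?p powr 3"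
      by (simp only: powr_powr) simp
    then show ?thesis using m[OF W(2)] by simp
  qed
  finally show ?thesis by simp
qed

end

text \<open>The rows of the frame transform as vector fields because the frame is real linear in the
  symbol coefficients. Taking determinants compares the orientation of the frame in two
  charts.\<close>

lemma (in first_order_system) frame_transform:
  assumes "\<kappa> \<in> \<A>" "\<kappa>' \<in> \<A>" "p \<in> fst \<kappa>" "p \<in> fst \<kappa>'"
  shows "frame (\<sigma> \<kappa>) (snd \<kappa> p) =
    frame (\<sigma> \<kappa>') (snd \<kappa>' p) ** transpose (jacobian (transition \<kappa>' \<kappa>) (at (snd \<kappa>' p)))"
proof -
  note T = symbol_transform[OF assms]
  have "frame (\<sigma> \<kappa>) (snd \<kappa> p) $ j $ \<beta> = (\<Sum>\<alpha>\<in>UNIV. frame (\<sigma> \<kappa>') (snd \<kappa>' p) $ j $ \<alpha> *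
      jacobian (transition \<kappa>' \<kappa>) (at (snd \<kappa>' p)) $ \<beta> $ \<alpha>)" for j \<beta>
    using exhaust_3[of j] by (auto simp: frame_nth T[of \<beta>] mult.commute sum_negf[symmetric])
  then show ?thesis by (simp add: vec_eq_iff matrix_matrix_mult_def transpose_def)
qed

theorem mainTheorem6:
  fixes M :: "'a topology"
    and \<A> \<O> :: "'a chart set"
    and A :: "('a chart \<Rightarrow> real^3 \<Rightarrow> complex^2) \<Rightarrow> ('a chart \<Rightarrow> real^3 \<Rightarrow> complex^2)"
    and \<sigma> :: "'a chart \<Rightarrow> real^3 \<Rightarrow> 3 \<Rightarrow> complex^2^2"
    and B :: "'a chart \<Rightarrow> real^3 \<Rightarrow> complex^2^2"
  assumes "smooth_manifold M \<A>"
    and "compact_space M"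
    and "connected_space M"
    and "oriented_atlas M \<A> \<O>"
    and "first_order_operator \<A> A \<sigma> B"
    and "elliptic \<A> \<sigma>"
    and "self_adjoint_operator M \<A> A"
    and "trace_free_symbol \<A> \<sigma>"
  shows "\<exists>c\<in>{1, -1}. is_relative_orientation \<O> \<sigma> c \<and>
    (\<forall>\<kappa>\<in>\<O>. \<forall>x\<in>chart_range \<kappa>. \<forall>\<xi>. \<xi> \<noteq> 0 \<longrightarrow>
      (\<forall>W v. open W \<and> (x, \<xi>) \<in> W \<and> W \<subseteq> chart_range \<kappa> \<times> (UNIV - {0}) \<and>
         local_positive_eigenvector (\<sigma> \<kappa>) W v \<longrightarrow>
         - \<i> * poisson_bracket (conj_row v) v (x, \<xi>) =
           complex_of_real (c / 2 *
             (\<Sum>\<alpha>\<in>UNIV. \<Sum>\<beta>\<in>UNIV. dual_torsion_raised (\<sigma> \<kappa>) x \<alpha> \<beta> * \<xi> $ \<alpha> * \<xi> $ \<beta>) /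
             (\<Sum>\<mu>\<in>UNIV. \<Sum>\<nu>\<in>UNIV. inv_metric (\<sigma> \<kappa>) x $ \<mu> $ \<nu> * \<xi> $ \<mu> * \<xi> $ \<nu>) powr (3 / 2))))"
proof -
  interpret first_order_system M \<A> A \<sigma> B
    by unfold_locales (rule assms)+
  have chart: "trace_free_symbol_chart (\<sigma> \<kappa>) (chart_range \<kappa>)" if \<kappa>: "\<kappa> \<in> \<A>" for \<kappa>
    using assms(6,8) symbol_hermitian[OF \<kappa> assms(2,7)] smooth_symbol[OF \<kappa>] open_chart_range[OF \<kappa>] \<kappa>
    unfolding trace_free_symbol_chart_def elliptic_def trace_free_symbol_def by blast
  have \<O>: "\<O> \<subseteq> \<A>" "(\<Union>\<kappa>\<in>\<O>. fst \<kappa>) = topspace M"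
    "\<And>\<kappa> \<kappa>' x. \<kappa> \<in> \<O> \<Longrightarrow> \<kappa>' \<in> \<O> \<Longrightarrow> x \<in> overlap \<kappa> \<kappa>' \<Longrightarrow> det (jacobian (transition \<kappa> \<kappa>') (at x)) > 0"
    using assms(4) by (auto simp: oriented_atlas_def smooth_atlas_def)
  define d where "d \<kappa> p = det (frame (\<sigma> \<kappa>) (snd \<kappa> p))" for \<kappa> p
  \<comment> \<open>The two determinants differ by a Jacobian determinant, which is positive within
    \<open>\<O>\<close>.\<close>
  have sgn_d: "sgn (d \<kappa> p) = sgn (d \<kappa>' p)"
    if k: "\<kappa> \<in> \<O>" "\<kappa>' \<in> \<O>" and p: "p \<in> fst \<kappa>" "p \<in> fst \<kappa>'" for \<kappa> \<kappa>' p
  proof -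
    have "det (jacobian (transition \<kappa>' \<kappa>) (at (snd \<kappa>' p))) > 0"
      using \<O>(3)[OF k(2,1)] p by (auto simp: overlap_def)
    moreover have "d \<kappa> p = d \<kappa>' p * det (jacobian (transition \<kappa>' \<kappa>) (at (snd \<kappa>' p)))"
      using frame_transform[OF subsetD[OF \<O>(1) k(1)] subsetD[OF \<O>(1) k(2)] p] by (simp add: d_def det_mul)
    ultimately show ?thesis by (simp add: sgn_mult)
  qed
  have d_nz: "d \<kappa> p \<noteq> 0" if "\<kappa> \<in> \<O>" "p \<in> fst \<kappa>" for \<kappa> p
    using trace_free_symbol_chart.det_frame_nonzero[OF chart] that \<O>(1)
    unfolding d_def chart_range_def by blast
  \<comment> \<open>The regions where the frame is positively (\<open>t = 1\<close>) and negatively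
    (\<open>t = -1\<close>) oriented. Both are open, they are disjoint and they cover
    \<open>M\<close>, so connectedness leaves one of them empty.\<close>
  define E where "E t = (\<Union>\<kappa>\<in>\<O>. {p \<in> fst \<kappa>. t * d \<kappa> p > 0})" for t :: real
  have "openin M (E t)" for t
    unfolding E_def
  proof (rule openin_Union, safe)
    fix \<kappa> assume "\<kappa> \<in> \<O>"
    then have \<kappa>: "\<kappa> \<in> \<A>" using \<O>(1) by blast
    interpret trace_free_symbol_chart "\<sigma> \<kappa>" "chart_range \<kappa>" by (rule chart[OF \<kappa>])
    have "continuous_on (chart_range \<kappa>) (\<lambda>x. t * det (frame (\<sigma> \<kappa>) x))"
      by (intro continuous_on_mult_left smooth_on_imp_continuous_on smooth_on_det_3 smooth_on_frame open_domain)
    then have "open (chart_range \<kappa> \<inter> (\<lambda>x. t * det (frame (\<sigma> \<kappa>) x)) -` {0<..})"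
      by (rule continuous_open_preimage[OF _ open_domain open_greaterThan])
    moreover have "{p \<in> fst \<kappa>. t * d \<kappa> p > 0} =
        {p \<in> fst \<kappa>. snd \<kappa> p \<in> chart_range \<kappa> \<inter> (\<lambda>x. t * det (frame (\<sigma> \<kappa>) x)) -` {0<..}}"
      by (auto simp: d_def chart_range_def)
    ultimately show "openin M {p \<in> fst \<kappa>. t * d \<kappa> p > 0}"
      using is_chart_openin_vimage[OF is_chart[OF \<kappa>]] by (simp only:)
  qed
  moreover have "topspace M \<subseteq> E 1 \<union> E (-1)"
  proof
    fix p assume "p \<in> topspace M"
    then obtain \<kappa> where \<kappa>: "\<kappa> \<in> \<O>" "p \<in> fst \<kappa>" using \<O>(2) by blast
    then have "1 * d \<kappa> p > 0 \<or> - 1 * d \<kappa> p > 0" using d_nz[of \<kappa> p] by auto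
    then show "p \<in> E 1 \<union> E (-1)" using \<kappa> unfolding E_def by blast
  qed
  moreover have "E 1 \<inter> E (-1) = {}"
  proof -
    have False if "\<kappa> \<in> \<O>" "\<kappa>' \<in> \<O>" "p \<in> fst \<kappa>" "p \<in> fst \<kappa>'" "d \<kappa> p > 0" "d \<kappa>' p < 0" for \<kappa> \<kappa>' p
      using sgn_d[OF that(1-4)] that(5,6) by simp
    then show ?thesis unfolding E_def by fastforce
  qed
  ultimately have "E 1 = {} \<or> E (-1) = {}"
    using assms(3) unfolding connected_space_def by blast
  \<comment> \<open>The sign is chosen opposite to that of an empty region, a choice that makes
    sense even if both regions are empty.\<close>
  then obtain c :: real where c: "c \<in> {1, -1}" "E (- c) = {}" by force
  have sgn_c: "sgn (det (frame (\<sigma> \<kappa>) x)) = c" if "\<kappa> \<in> \<O>" "x \<in> chart_range \<kappa>" for \<kappa> x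
  proof -
    obtain p where p: "p \<in> fst \<kappa>" "x = snd \<kappa> p" using \<open>x \<in> chart_range \<kappa>\<close> by (auto simp: chart_range_def)
    have "\<not> - c * d \<kappa> p > 0" using c(2) that(1) p(1) unfolding E_def by blast
    then show ?thesis using c(1) d_nz[OF that(1) p(1)] unfolding p(2) d_def by (auto simp: sgn_if)
  qed
  show ?thesis
  proof (rule bexI[OF _ c(1)], intro conjI ballI allI impI)
    show "is_relative_orientation \<O> \<sigma> c" unfolding is_relative_orientation_def using sgn_c by simp
  next
    fix \<kappa> x \<xi> W v
    assume \<kappa>: "\<kappa> \<in> \<O>" and x: "x \<in> chart_range \<kappa>"
      and W: "open W \<and> (x, \<xi>) \<in> W \<and> W \<subseteq> chart_range \<kappa> \<times> (UNIV - {0}) \<and> local_positive_eigenvector (\<sigma> \<kappa>) W v"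
    have "\<kappa> \<in> \<A>" using \<kappa> \<O>(1) by blast
    from trace_free_symbol_chart.poisson_bracket_eigenvector[OF chart[OF this], of W x \<xi> v] W
    show "- \<i> * poisson_bracket (conj_row v) v (x, \<xi>) =
           complex_of_real (c / 2 *
             (\<Sum>\<alpha>\<in>UNIV. \<Sum>\<beta>\<in>UNIV. dual_torsion_raised (\<sigma> \<kappa>) x \<alpha> \<beta> * \<xi> $ \<alpha> * \<xi> $ \<beta>) /
             (\<Sum>\<mu>\<in>UNIV. \<Sum>\<nu>\<in>UNIV. inv_metric (\<sigma> \<kappa>) x $ \<mu> $ \<nu> * \<xi> $ \<mu> * \<xi> $ \<nu>) powr (3 / 2))"
      unfolding sgn_c[OF \<kappa> x] by blast
  qed
qed

end
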